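(* Let $C\ge 1$ and $\lambda\in(1/2,1)$. Then there exists a constant $D=D(C,\lambda)$ such that for every $n$, every coral $G_n$ with parameters $\lambda$ and $\{N_i\}_{i=0}^n\subset\mathbb{N}$, and every Banach space $X$ which contains a basic sequence of length $\sum_{i=0}^n L(N_i)$ with basis constant $\le C$, there is an injective map $G_n\to X$ of distortion at most $D$. Here $L:\mathbb{N}\to\mathbb{N}$ is the function $$L(i)=\begin{cases}1 & \text{if } i=1,2,\\ 2 & \text{if } i=3,4,\\ \lceil\log_4 i\rceil & \text{if } i\ge 5.\end{cases}$$
   Context: Corals: pick $\lambda\in(\frac12,1)$ and natural numbers $N_0=2$, $N_i\ge1$ for $i\ge1$. A sequence of weighted graphs $\{G_n\}_{n\ge0}$, called corals, is defined inductively, with vertices and edges coming in generations $V_i$, $E_i$: - $G_0=(V_0,E_0)$, where $V_0$ consists of two vertices $v_0,v_1$, joined by one edge (the only element of $E_0$) of weight $1$. - Suppose $\bigcup_{i=0}^kV_i$, $\bigcup_{i=0}^kE_i$ and $G_k$ have been defined. Let $V_{k+1}$ be a set of cardinality $N_{k+1}$ disjoint from $\bigcup_{i=0}^kV_i$. The vertex set of $G_{k+1}$ is $\bigcup_{i=0}^{k+1}V_i$ and its edge set is $\bigcup_{i=0}^{k+1}E_i$, where the set $E_{k+1}$ of new edges is a set of edges joining vertices of $V_{k+1}$ with vertices of $\bigcup_{i=0}^kV_i$, each given weight $\lambda^{k+1}$. The edges in $E_{k+1}$ are chosen (otherwise arbitrarily) so that each vertex in $V_{k+1}$ has degree $1$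 or $2$ in $G_{k+1}$, and if $v\in V_{k+1}$ has degree $2$ in $G_{k+1}$, then it is adjacent to vertices $u,w\in\bigcup_{i=0}^kV_i$ which are joined by an edge $uw$ belonging to $E_k$ (so of length $\lambda^k$). The graph $G_n$ (which depends on $\lambda$, $N_1,\dots,N_n$, and the choices of attachments) is endowed with its weighted shortest path distance. The distortion of an injective map $f:X\to Y$ between metric spaces is $\sup_{x\ne y}\frac{d_Y(f(x),f(y))}{d_X(x,y)}\cdot\sup_{x\ne y}\frac{d_X(x,y)}{d_Y(f(x),f(y))}$. *)

theory Defs
  imports "HOL-Analysis.Analysis" "Graph_Theory.Shortest_Path" "Graph_Theory.Pair_Digraph"
begin

text \<open>Undirected graphs are symmetric digraphs: an edge joining \<open>u\<close> and \<open>w\<close> is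
  the pair of arcs \<open>(u, w)\<close>, \<open>(w, u)\<close>. Hence the degree of a vertex is its out-degree.\<close>

definition coral_graph ::
  "(nat \<Rightarrow> 'v set) \<Rightarrow> (nat \<Rightarrow> 'v rel) \<Rightarrow> nat \<Rightarrow> 'v pair_pre_digraph" where
  "coral_graph V E n = \<lparr> pverts = (\<Union>i\<le>n. V i), parcs = (\<Union>i\<le>n. E i) \<rparr>"

text \<open>\<open>coral N n V E\<close>: the generations \<open>V 0, \<dots>, V n\<close> of vertices and \<open>E 0, \<dots>, E n\<close>
  of edges form a coral with cardinalities \<open>N 0, \<dots>, N n\<close>. The values of \<open>N\<close>, \<open>V\<close>, \<open>E\<close>
  above \<open>n\<close> are irrelevant. The parameter \<open>\<lambda>\<close> only enters through the edge weights.\<close>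

primrec coral :: "(nat \<Rightarrow> nat) \<Rightarrow> nat \<Rightarrow> (nat \<Rightarrow> 'v set) \<Rightarrow> (nat \<Rightarrow> 'v rel) \<Rightarrow> bool" where
  "coral N 0 V E \<longleftrightarrow>
     N 0 = 2 \<and> (\<exists>v0 v1. v0 \<noteq> v1 \<and> V 0 = {v0, v1} \<and> E 0 = {(v0, v1), (v1, v0)})"
| "coral N (Suc k) V E \<longleftrightarrow>
     coral N k V E \<and>
     N (Suc k) \<ge> 1 \<and> finite (V (Suc k)) \<and> card (V (Suc k)) = N (Suc k) \<and>
     V (Suc k) \<inter> (\<Union>i\<le>k. V i) = {} \<and>
     sym (E (Suc k)) \<and>
     E (Suc k) \<subseteq> V (Suc k) \<times> (\<Union>i\<le>k. V i) \<union> (\<Union>i\<le>k. V i) \<times> V (Suc k) \<and>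
     (\<forall>v\<in>V (Suc k).
        out_degree (with_proj (coral_graph V E (Suc k))) v \<in> {1, 2} \<and>
        (out_degree (with_proj (coral_graph V E (Suc k))) v = 2 \<longrightarrow>
          (\<exists>u w. (v, u) \<in> E (Suc k) \<and> (v, w) \<in> E (Suc k) \<and> (u, w) \<in> E k)))"

text \<open>The generations of edges of a coral are disjoint, so \<open>LEAST\<close> picks the unique one.\<close>

definition coral_weight :: "real \<Rightarrow> (nat \<Rightarrow> 'v rel) \<Rightarrow> 'v \<times> 'v \<Rightarrow> real" where
  "coral_weight lam E e = lam ^ (LEAST i. e \<in> E i)"

definition coral_dist ::
  "real \<Rightarrow> nat \<Rightarrow> (nat \<Rightarrow> 'v set) \<Rightarrow> (nat \<Rightarrow> 'v rel) \<Rightarrow> 'v \<Rightarrow> 'v \<Rightarrow> real" where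
  "coral_dist lam n V E u v =
     real_of_ereal (wf_digraph.\<mu> (with_proj (coral_graph V E n)) (coral_weight lam E) u v)"

definition distortion ::
  "'v set \<Rightarrow> ('v \<Rightarrow> 'v \<Rightarrow> real) \<Rightarrow> ('b \<Rightarrow> 'b \<Rightarrow> real) \<Rightarrow> ('v \<Rightarrow> 'b) \<Rightarrow> ereal" where
  "distortion S dX dY f =
     (SUP (u, v)\<in>{(u, v). u \<in> S \<and> v \<in> S \<and> u \<noteq> v}. ereal (dY (f u) (f v) / dX u v)) *
     (SUP (u, v)\<in>{(u, v). u \<in> S \<and> v \<in> S \<and> u \<noteq> v}. ereal (dX u v / dY (f u) (f v)))"

text \<open>A finite sequence is basic iff it is linearly independent. Its basis constant is the supremum
  of the operator norms, on its span, of the partial sum projections.\<close>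

definition basic_sequence :: "nat \<Rightarrow> (nat \<Rightarrow> 'a::banach) \<Rightarrow> bool" where
  "basic_sequence m x \<longleftrightarrow> inj_on x {..<m} \<and> independent (x ` {..<m})"

definition basis_constant :: "nat \<Rightarrow> (nat \<Rightarrow> 'a::banach) \<Rightarrow> ereal" where
  "basis_constant m x =
     (SUP (k, a)\<in>{(k, a). k \<le> m \<and> (\<Sum>i<m. a i *\<^sub>R x i) \<noteq> 0}.
        ereal (norm (\<Sum>i<k. a i *\<^sub>R x i) / norm (\<Sum>i<m. a i *\<^sub>R x i)))"

definition coral_L :: "nat \<Rightarrow> nat" where
  "coral_L i =
     (if i = 1 \<or> i = 2 then 1
      else if i = 3 \<or> i = 4 then 2
      else nat \<lceil>log 4 (real i)\<rceil>)"

text \<open>HOL cannot quantify over types inside \<open>\<exists>D\<close>, and \<open>\<exists>D. P D\<close> about a type variable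
  \<open>'a::banach\<close> would let \<open>D\<close> depend on the Banach space. A bound that depends on \<open>C\<close> and \<open>\<lambda>\<close>
  only is therefore named by a constant of type \<open>real \<Rightarrow> real \<Rightarrow> real\<close>.

  To this end, \<open>D\<close> is chosen so as to work for all corals with vertices in \<open>nat\<close> and all
  \<open>m\<close>-dimensional spaces with norm given in coordinates with respect to a basic sequence:
  \<open>p a\<close> plays the role of \<open>\<parallel>\<Sum>i<m. a i *\<^sub>R x i\<parallel>\<close>, and only the coordinates below \<open>m\<close> matter.
  If the result holds for all Banach spaces, then such \<open>D\<close> exist, and each of them works for
  all corals over any type and all Banach spaces, since a Banach space contains the span of the
  given basic sequence.\<close>

definition coord_norm :: "nat \<Rightarrow> ((nat \<Rightarrow> real) \<Rightarrow> real) \<Rightarrow> bool" where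
  "coord_norm m p \<longleftrightarrow>
     (\<forall>a b. p (\<lambda>i. a i + b i) \<le> p a + p b) \<and>
     (\<forall>c a. p (\<lambda>i. c * a i) = \<bar>c\<bar> * p a) \<and>
     (\<forall>a. p a = 0 \<longleftrightarrow> (\<forall>i<m. a i = 0))"

definition coord_basis_constant :: "nat \<Rightarrow> ((nat \<Rightarrow> real) \<Rightarrow> real) \<Rightarrow> ereal" where
  "coord_basis_constant m p =
     (SUP (k, a)\<in>{(k, a). k \<le> m \<and> p a \<noteq> 0}. ereal (p (\<lambda>i. if i < k then a i else 0) / p a))"

definition coral_distortion_bound :: "real \<Rightarrow> real \<Rightarrow> real" where
  "coral_distortion_bound C lam = (SOME D.
     \<forall>n N (V :: nat \<Rightarrow> nat set) E p.
       coral N n V E \<longrightarrow>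
       coord_norm (\<Sum>i\<le>n. coral_L (N i)) p \<longrightarrow>
       coord_basis_constant (\<Sum>i\<le>n. coral_L (N i)) p \<le> ereal C \<longrightarrow>
       (\<exists>f. (\<forall>u\<in>pverts (coral_graph V E n). \<forall>v\<in>pverts (coral_graph V E n).
               u \<noteq> v \<longrightarrow> p (\<lambda>i. f u i - f v i) \<noteq> 0) \<and>
            distortion (pverts (coral_graph V E n)) (coral_dist lam n V E)
              (\<lambda>a b. p (\<lambda>i. a i - b i)) f \<le> ereal D))"

end

theory Submission
  imports Defs
begin

text \<open>
  Why the theorem holds. Generation \<open>k\<close> of the coral receives its own block of \<open>L(N\<^sub>k)\<close> consecutive
  basis vectors. A new vertex \<open>v\<close> of generation \<open>k \<ge> 1\<close> is sent to the average of the images of its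
  older neighbours plus \<open>\<lambda>\<^sup>k z\<^sub>v\<close>, where the \<open>z\<^sub>v\<close> are unit vectors in the span of the \<open>k\<close>-th block
  which keep a distance of at least \<open>1/512\<close> from each other; the two initial vertices are sent to
  such unit vectors themselves. The function \<open>L\<close> is just large enough for
  this: one dimension carries two such vectors, and \<open>d \<ge> 2\<close> dimensions carry \<open>4^d\<close> of them
  (\<open>separated_unit_vectors\<close>), by comparing the number of points of a fine grid with the number of small
  balls that are needed to cover the unit ball.

  The map is Lipschitz (\<open>f_edge_le\<close>): if it stretches the edges of generation \<open>k\<close> by at most \<open>A\<close>, then
  it stretches those of generation \<open>k + 1\<close> by at most \<open>A / (2 \<lambda>) + 1\<close>. For \<open>\<lambda> > 1/2\<close> the fixed point
  \<open>A = 2 \<lambda> / (2 \<lambda> - 1)\<close> of this recursion bounds all generations.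

  For the lower bound (\<open>vertices_separated\<close>), extend the map affinely to the edges. Cutting off the blocks
  above \<open>j\<close> corresponds to a retraction onto the edges of the \<open>j\<close>-th coral: a new vertex goes to the
  midpoint of its older neighbours, or to its only neighbour. Follow the retractions of two distinct
  vertices for growing \<open>j\<close>. As long as they lie on one edge, the difference of their parameters doubles
  whenever this edge is subdivided. Once they lie on different edges near a common vertex, it is their
  parameters, counted from this vertex, that double. As two distinct vertices do not remain close in this
  relative sense, at some generation \<open>i\<close> the \<open>i\<close>-th blocks differ by at least a fixed multiple of
  \<open>\<lambda>\<^sup>i\<close>, while the retractions, and therefore the two vertices themselves, are still within a multiple
  of \<open>\<lambda>\<^sup>i\<close> of each other. The projection onto a block has norm at most \<open>2 C\<close>, so that the distance of the images is at least a multiple of \<open>\<lambda>\<^sup>i\<close>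
  (\<open>coral_embedding\<close>). The doubling argument is organised as an invariant of pairs of points, which is
  carried from one generation to the next (\<open>trichotomy\<close>).

  Everything is done for norms on coordinate vectors. The last section copies a coral to the natural
  numbers, pulls the norm of the Banach space back to coordinates and transports the embedding.
\<close>

section \<open>Separated points on unit spheres\<close>

text \<open>
  Vectors with finitely many coordinates are functions on the whole index type, so that one norm
  serves all blocks; a vector of a block is one supported on the index set of the block.
\<close>

definition supported_on :: "'i set \<Rightarrow> ('i \<Rightarrow> real) \<Rightarrow> bool" where
  "supported_on I a \<longleftrightarrow> (\<forall>i. i \<notin> I \<longrightarrow> a i = 0)"

lemma supported_on_zero [simp]: "supported_on I (\<lambda>i. 0)"
  by (simp add: supported_on_def)

lemma supported_on_add: "supported_on I a \<Longrightarrow> supported_on I b \<Longrightarrow> supported_on I (\<lambda>i. a i + c * b i)"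
  by (simp add: supported_on_def)

locale coord_seminorm =
  fixes q :: "('i \<Rightarrow> real) \<Rightarrow> real"
  assumes sub: "q (\<lambda>i. a i + b i) \<le> q a + q b"
    and hom: "q (\<lambda>i. c * a i) = \<bar>c\<bar> * q a"
begin

lemma zero [simp]: "q (\<lambda>i. 0) = 0"
  using hom[of 0 "\<lambda>i. 0"] by simp

lemma minus: "q (\<lambda>i. - a i) = q a"
  using hom[of "-1" a] by simp

lemma nonneg [simp]: "0 \<le> q a"
  using sub[of a "\<lambda>i. - a i"] by (simp add: minus)

lemma diff_le: "q (\<lambda>i. a i - b i) \<le> q a + q b"
  using sub[of a "\<lambda>i. - b i"] by (simp add: minus)

lemma diff_swap: "q (\<lambda>i. a i - b i) = q (\<lambda>i. b i - a i)"
  using minus[of "\<lambda>i. a i - b i"] by simp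

lemma triangle: "q (\<lambda>i. a i - b i) \<le> q (\<lambda>i. a i - d i) + q (\<lambda>i. d i - b i)"
  using sub[of "\<lambda>i. a i - d i" "\<lambda>i. d i - b i"] by simp

lemma reverse_triangle: "q a - q b \<le> q (\<lambda>i. a i - b i)"
  using sub[of "\<lambda>i. a i - b i" b] by simp

lemma sum_le: "finite A \<Longrightarrow> q (\<lambda>i. \<Sum>j\<in>A. g j i) \<le> (\<Sum>j\<in>A. q (g j))"
proof (induction A rule: finite_induct)
  case (insert x A)
  then show ?case using sub[of "g x" "\<lambda>i. \<Sum>j\<in>A. g j i"] by simp
qed simp

lemma unit_rescale: "q a \<noteq> 0 \<Longrightarrow> q (\<lambda>i. a i / q a) = 1"
  using hom[of "1 / q a" a] by simp

text \<open>
  Separated unit vectors span separated rays. If \<open>s\<close> and \<open>t\<close> are far apart, the norms alone tell the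
  two points from each other; otherwise the distance of \<open>s a\<close> and \<open>t b\<close> is about \<open>s\<close> times that
  of \<open>a\<close> and \<open>b\<close>. This is the reason for taking the \<open>z\<^sub>v\<close> on the sphere rather than in the ball.
\<close>

lemma separated_rays:
  assumes "q a = 1" "q b = 1" "c \<le> q (\<lambda>i. a i - b i)" "0 \<le> s" "0 \<le> t"
  shows "c / 2 * max s t \<le> q (\<lambda>i. s * a i - t * b i)"
proof -
  have *: "c / 2 * s \<le> q (\<lambda>i. s * a i - t * b i)"
    if "q a = 1" "q b = 1" "c \<le> q (\<lambda>i. a i - b i)" "0 \<le> t" "t \<le> s" for a b s t
  proof -
    have "q (\<lambda>i. s * (a i - b i)) \<le> q (\<lambda>i. s * a i - t * b i) + q (\<lambda>i. t * b i - s * b i)"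
      using triangle[of "\<lambda>i. s * a i" "\<lambda>i. s * b i" "\<lambda>i. t * b i"] by (simp add: algebra_simps)
    moreover have "q (\<lambda>i. t * b i - s * b i) = s - t"
      using hom[of "t - s" b] that by (simp add: algebra_simps)
    moreover have "s - t \<le> q (\<lambda>i. s * a i - t * b i)"
      using reverse_triangle[of "\<lambda>i. s * a i" "\<lambda>i. t * b i"] that by (simp add: hom)
    moreover have "s * c \<le> q (\<lambda>i. s * (a i - b i))"
      using that by (simp add: hom mult_left_mono)
    ultimately show ?thesis by (simp add: algebra_simps)
  qed
  show ?thesis
  proof (cases "t \<le> s")
    case True
    then show ?thesis using *[of a b t s] assms by simp
  next
    case False
    have "c \<le> q (\<lambda>i. b i - a i)" using assms(3) diff_swap[of a b] by simp
    then show ?thesis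
      using *[of b a s t] assms False diff_swap[of "\<lambda>i. s * a i" "\<lambda>i. t * b i"] by simp
  qed
qed

text \<open>
  Covering each of the small balls by a scaled copy of the same cover multiplies the number of
  centres, and the radius, by constant factors.
\<close>

lemma iterate_cover:
  assumes "finite T" "\<rho> > 0"
    and supp: "\<And>t. t \<in> T \<Longrightarrow> supported_on I t"
    and cover: "\<And>a. supported_on I a \<Longrightarrow> q a \<le> 1 \<Longrightarrow> \<exists>t\<in>T. q (\<lambda>i. a i - t i) \<le> \<rho>"
  shows "\<exists>U. finite U \<and> card U \<le> card T ^ k \<and>
    (\<forall>a. supported_on I a \<longrightarrow> q a \<le> 1 \<longrightarrow> (\<exists>u\<in>U. q (\<lambda>i. a i - u i) \<le> \<rho> ^ k)) \<and>
    (\<forall>u\<in>U. supported_on I u)"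
proof (induction k)
  case 0
  show ?case by (rule exI[of _ "{\<lambda>i. 0}"]) auto
next
  case (Suc k)
  then obtain U where U: "finite U" "card U \<le> card T ^ k"
    "\<And>a. supported_on I a \<Longrightarrow> q a \<le> 1 \<Longrightarrow> \<exists>u\<in>U. q (\<lambda>i. a i - u i) \<le> \<rho> ^ k"
    "\<And>u. u \<in> U \<Longrightarrow> supported_on I u" by metis
  define W where "W = (\<lambda>(u, t). \<lambda>i. u i + \<rho> ^ k * t i) ` (U \<times> T)"
  have "card W \<le> card (U \<times> T)"
    unfolding W_def by (rule card_image_le) (use U(1) assms(1) in simp)
  also have "\<dots> \<le> card T ^ Suc k" using U(2) by (simp add: card_cartesian_product)
  finally have "card W \<le> card T ^ Suc k" .
  moreover have "\<exists>w\<in>W. q (\<lambda>i. a i - w i) \<le> \<rho> ^ Suc k"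
    if a: "supported_on I a" "q a \<le> 1" for a
  proof -
    obtain u where u: "u \<in> U" "q (\<lambda>i. a i - u i) \<le> \<rho> ^ k" using U(3)[OF a] by blast
    have r: "\<rho> ^ k > 0" using assms(2) by simp
    let ?b = "\<lambda>i. (1 / \<rho> ^ k) * (a i - u i)"
    have "q ?b \<le> 1" unfolding hom using u r by simp
    moreover have "supported_on I ?b" using a U(4) u by (simp add: supported_on_def)
    ultimately obtain t where t: "t \<in> T" "q (\<lambda>i. ?b i - t i) \<le> \<rho>" using cover[of ?b] by blast
    have "x - (y + r * z) = r * (1 / r * (x - y) - z)" if "r > 0" for r x y z :: real
      using that by (simp add: field_simps)
    then have "q (\<lambda>i. a i - (u i + \<rho> ^ k * t i)) = q (\<lambda>i. \<rho> ^ k * (?b i - t i))"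
      using r by (simp only:)
    also have "\<dots> \<le> \<rho> ^ Suc k" unfolding hom using r t(2) by (simp add: mult_left_mono)
    finally have "q (\<lambda>i. a i - (u i + \<rho> ^ k * t i)) \<le> \<rho> ^ Suc k" .
    moreover have "(\<lambda>i. u i + \<rho> ^ k * t i) \<in> W"
      unfolding W_def using u t by (intro image_eqI[of _ _ "(u, t)"]) auto
    ultimately show ?thesis by (rule bexI)
  qed
  moreover have "finite W" unfolding W_def using U(1) assms(1) by simp
  moreover have "\<forall>w\<in>W. supported_on I w"
    unfolding W_def using U(4) supp by (auto intro!: supported_on_add)
  ultimately show ?case by blast
qed

text \<open>
  The volume estimate for covers, without volumes. In the unit ball lies a grid with \<open>Q ^ card I\<close> points
  whose distances are at least a constant times \<open>1 / Q\<close>. For \<open>Q = 128 ^ k\<close> and large \<open>k\<close> these distances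
  exceed the diameter of the balls of radius \<open>(1/256) ^ k\<close> in the \<open>k\<close>-fold iterated cover, so that
  \<open>(128 ^ card I) ^ k \<le> card T ^ k\<close>.
\<close>

lemma card_cover_ge:
  assumes "finite I" "finite T"
    and coord: "\<And>a i. i \<in> I \<Longrightarrow> supported_on I a \<Longrightarrow> \<bar>a i\<bar> \<le> R * q a"
    and supp: "\<And>t. t \<in> T \<Longrightarrow> supported_on I t"
    and cover: "\<And>a. supported_on I a \<Longrightarrow> q a \<le> 1 \<Longrightarrow>
                  \<exists>t\<in>T. q (\<lambda>i. a i - t i) \<le> 1 / 256"
  shows "128 ^ card I \<le> card T"
proof (cases "I = {}")
  case True
  have "T \<noteq> {}" using cover[of "\<lambda>i. 0"] by auto
  then show ?thesis using True assms(2) by (simp add: Suc_leI card_gt_0_iff)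
next
  case False
  define e :: "'i \<Rightarrow> 'i \<Rightarrow> real" where "e j = (\<lambda>i. if i = j then 1 else 0)" for j
  have R: "R > 0"
  proof -
    obtain j where "j \<in> I" using False by blast
    moreover have "supported_on I (e j)" using \<open>j \<in> I\<close> by (auto simp: e_def supported_on_def)
    ultimately have "1 \<le> R * q (e j)" using coord[of j "e j"] by (simp add: e_def)
    then show ?thesis using mult_nonpos_nonneg[of R "q (e j)"] by (cases "R > 0") auto
  qed
  \<comment> \<open>The box with sides \<open>\<delta>\<close> lies in the unit ball.\<close>
  define \<delta> where "\<delta> = 1 / (1 + (\<Sum>j\<in>I. q (e j)))"
  have e_sum: "0 \<le> (\<Sum>j\<in>I. q (e j))" by (rule sum_nonneg) simp
  then have \<delta>: "\<delta> > 0" "\<delta> * (\<Sum>j\<in>I. q (e j)) \<le> 1" by (auto simp: \<delta>_def field_simps)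
  obtain k where k: "2 * R / \<delta> < 2 ^ k" "k > 0"
  proof -
    obtain k :: nat where k: "2 * R / \<delta> < 2 ^ k" using real_arch_pow[of 2 "2 * R / \<delta>"] by auto
    also have "(2::real) ^ k \<le> 2 ^ Suc k" by simp
    finally have "2 * R / \<delta> < 2 ^ Suc k" .
    then show thesis using that[of "Suc k"] by simp
  qed
  have "(1/256::real) > 0" by simp
  from iterate_cover[OF assms(2) this supp cover, of k]
  obtain U where U: "finite U" "card U \<le> card T ^ k"
    "\<forall>a. supported_on I a \<longrightarrow> q a \<le> 1 \<longrightarrow> (\<exists>u\<in>U. q (\<lambda>i. a i - u i) \<le> (1/256) ^ k)"
    by blast
  define Q :: nat where "Q = 128 ^ k"
  define vec where "vec g = (\<lambda>i. if i \<in> I then \<delta> * real (g i) / real Q else 0)" for g :: "'i \<Rightarrow> nat"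
  define Grid where "Grid = PiE I (\<lambda>_. {..<Q})"
  have Q: "real Q > 0" by (simp add: Q_def)
  have vec_le: "q (vec g) \<le> 1" if g: "g \<in> Grid" for g
  proof -
    have "vec g = (\<lambda>i. \<Sum>j\<in>I. (\<delta> * real (g j) / real Q) * e j i)"
      by (rule ext) (use assms(1) in \<open>simp add: vec_def e_def if_distrib cong: if_cong\<close>)
    then have "q (vec g) \<le> (\<Sum>j\<in>I. q (\<lambda>i. (\<delta> * real (g j) / real Q) * e j i))"
      using sum_le[OF assms(1)] by simp
    also have "\<dots> \<le> (\<Sum>j\<in>I. \<delta> * q (e j))"
    proof (rule sum_mono)
      fix j assume "j \<in> I"
      then have "g j < Q" using g by (auto simp: Grid_def)
      then have "\<delta> * real (g j) / real Q \<le> \<delta>" using \<delta> Q by (simp add: field_simps)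
      then have "\<bar>\<delta> * real (g j) / real Q\<bar> \<le> \<delta>" using \<delta> by (simp add: abs_mult)
      then show "q (\<lambda>i. (\<delta> * real (g j) / real Q) * e j i) \<le> \<delta> * q (e j)"
        unfolding hom by (rule mult_right_mono) simp
    qed
    also have "\<dots> \<le> 1" using \<delta> by (simp add: sum_distrib_left)
    finally show ?thesis .
  qed
  have "\<exists>u\<in>U. q (\<lambda>i. vec g i - u i) \<le> (1/256) ^ k" if "g \<in> Grid" for g
    by (rule U(3)[rule_format, OF _ vec_le[OF that]]) (auto simp: vec_def supported_on_def)
  then obtain h where h: "\<And>g. g \<in> Grid \<Longrightarrow> h g \<in> U \<and> q (\<lambda>i. vec g i - h g i) \<le> (1/256) ^ k"
    by metis
  have "inj_on h Grid"
  proof (rule inj_onI, rule ccontr)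
    fix g g' assume g: "g \<in> Grid" "g' \<in> Grid" "h g = h g'" "g \<noteq> g'"
    then obtain j where j: "j \<in> I" "g j \<noteq> g' j"
      unfolding Grid_def by (metis PiE_ext)
    have "1 \<le> \<bar>real (g j) - real (g' j)\<bar>" using j by linarith
    then have "\<delta> / Q * 1 \<le> \<delta> / Q * \<bar>real (g j) - real (g' j)\<bar>"
      using \<delta> Q by (intro mult_left_mono) auto
    also have "\<dots> = \<bar>\<delta> / Q * (real (g j) - real (g' j))\<bar>"
      using \<delta> Q by (simp only: abs_mult) simp
    also have "\<dots> = \<bar>vec g j - vec g' j\<bar>" using j by (simp add: vec_def algebra_simps diff_divide_distrib)
    also have "\<dots> \<le> R * q (\<lambda>i. vec g i - vec g' i)"
      using coord[of j "\<lambda>i. vec g i - vec g' i"] j by (simp add: vec_def supported_on_def)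
    also have "q (\<lambda>i. vec g i - vec g' i) \<le> 2 * (1/256) ^ k"
      using triangle[of "vec g" "vec g'" "h g"] h[OF g(1)] h[OF g(2)] g(3)
        diff_swap[of "vec g'" "h g'"] by simp
    finally have "\<delta> / Q \<le> 2 * R * (1/256) ^ k" using R by simp
    then have "\<delta> * 256 ^ k \<le> 2 * R * 128 ^ k"
      by (simp add: Q_def field_simps)
    also have "(256::real) ^ k = 2 ^ k * 128 ^ k" by (simp flip: power_mult_distrib)
    finally have "\<delta> * 2 ^ k \<le> 2 * R" by (simp flip: mult.assoc)
    then show False using k \<delta> by (simp add: field_simps)
  qed
  then have "card Grid \<le> card U"
    using h U(1) by (intro card_inj_on_le[of h]) auto
  also have "card Grid = Q ^ card I" using assms(1) by (simp add: Grid_def card_PiE)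
  finally have "(128 ^ card I) ^ k \<le> card T ^ k"
    using U(2) by (simp add: Q_def mult.commute flip: power_mult)
  then show ?thesis using k(2) by (simp add: power_mono_iff)
qed

text \<open>
  A maximal separated set \<open>Z\<close> on the sphere has a point near every unit vector, so its multiples by
  \<open>t / 512\<close> with \<open>t \<le> 512\<close> cover the ball. These are \<open>513 \<cdot> card Z\<close> points; in dimension one the
  factor would be too large, but in two or more dimensions \<open>128 ^ d \<ge> 513 \<cdot> 4 ^ d\<close>.
\<close>

lemma separated_unit_vectors:
  assumes "finite I" "2 \<le> card I"
    and coord: "\<And>a i. i \<in> I \<Longrightarrow> supported_on I a \<Longrightarrow> \<bar>a i\<bar> \<le> R * q a"
  shows "\<exists>Z. finite Z \<and> 4 ^ card I \<le> card Z \<and> (\<forall>z\<in>Z. q z = 1 \<and> supported_on I z) \<and>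
    (\<forall>z\<in>Z. \<forall>w\<in>Z. z \<noteq> w \<longrightarrow> 1/512 \<le> q (\<lambda>i. z i - w i))"
proof (rule ccontr)
  define sep where "sep Z \<longleftrightarrow> finite Z \<and> (\<forall>z\<in>Z. q z = 1 \<and> supported_on I z) \<and>
    (\<forall>z\<in>Z. \<forall>w\<in>Z. z \<noteq> w \<longrightarrow> 1/512 \<le> q (\<lambda>i. z i - w i))" for Z
  assume "\<not> ?thesis"
  then have small: "card Z < 4 ^ card I" if "sep Z" for Z
    using that unfolding sep_def by (meson not_le)
  have "sep {}" by (simp add: sep_def)
  then obtain Z where Z: "sep Z" "\<And>Z'. sep Z' \<Longrightarrow> card Z' \<le> card Z"
    using ex_has_greatest_nat[of sep "{}" card "4 ^ card I"] small by (metis less_imp_le)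
  have fin: "finite Z" using Z by (simp add: sep_def)
  have max: "\<exists>z\<in>Z. q (\<lambda>i. y i - z i) < 1/512" if y: "q y = 1" "supported_on I y" for y
  proof (rule ccontr)
    assume "\<not> ?thesis"
    then have far: "\<And>z. z \<in> Z \<Longrightarrow> 1/512 \<le> q (\<lambda>i. y i - z i)" by (meson not_le)
    have "y \<notin> Z" using far[of y] by auto
    moreover have "sep (insert y Z)"
      using Z(1) y far unfolding sep_def by (auto simp: diff_swap[of y])
    ultimately show False using Z(2)[of "insert y Z"] fin by simp
  qed
  define T where "T = (\<lambda>(t, z). \<lambda>i. real t / 512 * z i) ` ({..512::nat} \<times> Z)"
  have "128 ^ card I \<le> card T"
  proof (rule card_cover_ge[OF assms(1) _ coord])
    show "finite T" using fin by (simp add: T_def)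
    show "supported_on I t" if "t \<in> T" for t
      using that Z(1) by (auto simp: T_def sep_def supported_on_def)
    fix a :: "'i \<Rightarrow> real" assume a: "supported_on I a" "q a \<le> 1"
    show "\<exists>t\<in>T. q (\<lambda>i. a i - t i) \<le> 1 / 256"
    proof (cases "q a = 0")
      case True
      obtain j where j: "j \<in> I" using assms(2) by fastforce
      define e :: "'i \<Rightarrow> real" where "e = (\<lambda>i. if i = j then 1 else 0)"
      have e: "supported_on I e" using j by (auto simp: e_def supported_on_def)
      then have "q e \<noteq> 0" using coord[OF j e] by (auto simp: e_def)
      then have "\<exists>z\<in>Z. q (\<lambda>i. e i / q e - z i) < 1/512"
        by (intro max unit_rescale) (use e in \<open>simp_all add: supported_on_def\<close>)
      then obtain z where "z \<in> Z" by blast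
      then have "(\<lambda>i. 0) \<in> T" unfolding T_def by (intro image_eqI[of _ _ "(0, z)"]) auto
      then show ?thesis by (rule bexI[rotated]) (simp add: True)
    next
      case False
      then have qa: "q a > 0" using nonneg[of a] by (simp only: less_le) simp
      have "\<exists>z\<in>Z. q (\<lambda>i. a i / q a - z i) < 1/512"
        by (intro max unit_rescale) (use a False in \<open>simp_all add: supported_on_def\<close>)
      then obtain z where z: "z \<in> Z" "q (\<lambda>i. a i / q a - z i) < 1/512" by blast
      define t where "t = nat \<lfloor>512 * q a\<rfloor>"
      have t: "real t \<le> 512 * q a" "512 * q a < real t + 1"
        using qa by (auto simp: t_def)
      then have "t \<le> 512" using a(2) by linarith
      have "q (\<lambda>i. a i - real t / 512 * z i)
          \<le> q (\<lambda>i. q a * (a i / q a - z i)) + q (\<lambda>i. (q a - real t / 512) * z i)"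
        using sub[of "\<lambda>i. q a * (a i / q a - z i)" "\<lambda>i. (q a - real t / 512) * z i"] qa
        by (simp add: algebra_simps)
      also have "\<dots> = q a * q (\<lambda>i. a i / q a - z i) + (q a - real t / 512)"
        unfolding hom using Z(1) z(1) t(1) qa by (simp add: sep_def)
      also have "\<dots> \<le> 1 * (1/512) + 1/512"
        by (rule add_mono[OF mult_mono]) (use a(2) z(2) t qa in auto)
      finally have "q (\<lambda>i. a i - real t / 512 * z i) \<le> 1/256" by simp
      moreover have "(\<lambda>i. real t / 512 * z i) \<in> T"
        unfolding T_def using z(1) \<open>t \<le> 512\<close> by (intro image_eqI[of _ _ "(t, z)"]) auto
      ultimately show ?thesis by (rule bexI)
    qed
  qed
  also have "card T \<le> card ({..512::nat} \<times> Z)"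
    unfolding T_def by (rule card_image_le) (use fin in simp)
  also have "\<dots> = 513 * card Z" by (simp add: card_cartesian_product)
  also have "\<dots> < 513 * 4 ^ card I" using small[OF Z(1)] by simp
  also have "\<dots> \<le> 32 ^ card I * 4 ^ card I"
    using power_increasing[OF assms(2), of "32::nat"] by (intro mult_right_mono) auto
  also have "\<dots> = 128 ^ card I" by (simp flip: power_mult_distrib)
  finally show False by simp
qed

end

section \<open>The structure of corals\<close>

definition gens_upto :: "(nat \<Rightarrow> 'v set) \<Rightarrow> nat \<Rightarrow> 'v set" where
  "gens_upto V k = (\<Union>i\<le>k. V i)"

lemma gens_upto_0: "gens_upto V 0 = V 0"
  by (simp add: gens_upto_def)

lemma gens_upto_Suc: "gens_upto V (Suc k) = gens_upto V k \<union> V (Suc k)"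
  by (auto simp: gens_upto_def le_Suc_eq)

lemma gens_upto_mono: "j \<le> k \<Longrightarrow> gens_upto V j \<subseteq> gens_upto V k"
  by (fastforce simp: gens_upto_def)

lemma coral_SucD:
  assumes "coral N (Suc k) V E"
  shows "coral N k V E" "finite (V (Suc k))" "card (V (Suc k)) = N (Suc k)" "N (Suc k) \<ge> 1"
    "V (Suc k) \<inter> gens_upto V k = {}" "sym (E (Suc k))"
    "E (Suc k) \<subseteq> V (Suc k) \<times> gens_upto V k \<union> gens_upto V k \<times> V (Suc k)"
  using assms by (simp_all only: coral.simps gens_upto_def)

lemma coral_le: "coral N n V E \<Longrightarrow> k \<le> n \<Longrightarrow> coral N k V E"
  by (induction n) (auto simp: le_Suc_eq simp del: coral.simps dest: coral_SucD(1))

lemma coral_edges_subset: "coral N k V E \<Longrightarrow> E k \<subseteq> gens_upto V k \<times> gens_upto V k"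
proof (cases k)
  case (Suc j)
  then show "coral N k V E \<Longrightarrow> ?thesis" using coral_SucD(7)[of N j V E] unfolding Suc gens_upto_Suc by blast
qed (auto simp: gens_upto_0)

lemma coral_finite: "coral N k V E \<Longrightarrow> finite (gens_upto V k)"
proof (induction k)
  case (Suc k)
  then show ?case using coral_SucD(1,2)[OF Suc.prems] by (simp add: gens_upto_Suc)
qed (auto simp: gens_upto_0)

lemma coral_no_loops: "coral N k V E \<Longrightarrow> (v, v) \<notin> E k"
proof (cases k)
  case (Suc j)
  then show "coral N k V E \<Longrightarrow> ?thesis" using coral_SucD(5,7)[of N j V E] by blast
qed auto

lemma coral_sym: "coral N k V E \<Longrightarrow> sym (E k)"
proof (cases k)
  case (Suc j)
  then show "coral N k V E \<Longrightarrow> ?thesis" using coral_SucD(6)[of N j V E] by simp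
qed (auto simp: sym_def)

lemma coral_out_degree:
  assumes "coral N k V E" "v \<notin> gens_upto V k"
  shows "out_degree (with_proj (coral_graph V E (Suc k))) v = card {b. (v, b) \<in> E (Suc k)}"
proof -
  have "(v, b) \<notin> E i" if "i \<le> k" for b i
    using coral_edges_subset[OF coral_le[OF assms(1) that]] gens_upto_mono[OF that, of V] assms(2)
    by auto
  then have "out_arcs (with_proj (coral_graph V E (Suc k))) v = Pair v ` {b. (v, b) \<in> E (Suc k)}"
    by (auto simp: out_arcs_def coral_graph_def le_Suc_eq)
  then show ?thesis by (simp add: out_degree_def card_image inj_on_def)
qed

text \<open>
  The condition on the degree in a form that treats both cases alike: a new vertex has the neighbours \<open>u\<close>
  and \<open>w\<close>, which either coincide or are joined by an edge of the preceding generation. In this form the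
  condition is visibly invariant under renaming of vertices.
\<close>

lemma coral_Suc_iff:
  "coral N (Suc k) V E \<longleftrightarrow>
     coral N k V E \<and> N (Suc k) \<ge> 1 \<and> finite (V (Suc k)) \<and> card (V (Suc k)) = N (Suc k) \<and>
     V (Suc k) \<inter> gens_upto V k = {} \<and> sym (E (Suc k)) \<and>
     E (Suc k) \<subseteq> V (Suc k) \<times> gens_upto V k \<union> gens_upto V k \<times> V (Suc k) \<and>
     (\<forall>v\<in>V (Suc k). \<exists>u w. {b. (v, b) \<in> E (Suc k)} = {u, w} \<and> (u = w \<or> (u, w) \<in> E k))"
    (is "?L \<longleftrightarrow> ?R")
proof -
  let ?D = "\<lambda>v. out_degree (with_proj (coral_graph V E (Suc k))) v"
  have *: "(?D v \<in> {1, 2} \<and> (?D v = 2 \<longrightarrow>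
          (\<exists>u w. (v, u) \<in> E (Suc k) \<and> (v, w) \<in> E (Suc k) \<and> (u, w) \<in> E k))) \<longleftrightarrow>
      (\<exists>u w. {b. (v, b) \<in> E (Suc k)} = {u, w} \<and> (u = w \<or> (u, w) \<in> E k))" (is "?P \<longleftrightarrow> ?Q")
    if "coral N k V E" "v \<in> V (Suc k)" "V (Suc k) \<inter> gens_upto V k = {}" for v
  proof -
    have D: "?D v = card {b. (v, b) \<in> E (Suc k)}"
      using that by (intro coral_out_degree) auto
    have loop: "(u, u) \<notin> E k" for u using coral_no_loops[OF that(1)] .
    show ?thesis
    proof
      assume P: ?P
      show ?Q
      proof (cases "?D v = 1")
        case True
        then obtain u where "{b. (v, b) \<in> E (Suc k)} = {u}" unfolding D by (rule card_1_singletonE)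
        then show ?thesis by (intro exI[of _ u]) auto
      next
        case False
        then have 2: "?D v = 2" using P by auto
        then obtain u w where uw: "(v, u) \<in> E (Suc k)" "(v, w) \<in> E (Suc k)" "(u, w) \<in> E k"
          using P by auto
        have "u \<noteq> w" using uw loop by auto
        have "{u, w} = {b. (v, b) \<in> E (Suc k)}"
        proof (rule card_subset_eq)
          show "finite {b. (v, b) \<in> E (Suc k)}" using 2 unfolding D by (intro card_ge_0_finite) simp
        qed (use 2 uw \<open>u \<noteq> w\<close> D in auto)
        then show ?thesis using uw by metis
      qed
    next
      assume ?Q
      then obtain u w where "{b. (v, b) \<in> E (Suc k)} = {u, w}" "u = w \<or> (u, w) \<in> E k" by auto
      then show ?P unfolding D by (cases "u = w") auto
    qed
  qed
  show ?thesis
  proof (cases "coral N k V E \<and> V (Suc k) \<inter> gens_upto V k = {}")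
    case True
    then show ?thesis
      unfolding coral.simps gens_upto_def[symmetric]
      by (simp only: ball_cong[OF refl *] simp_thms)
  next
    case False
    then show ?thesis
      unfolding coral.simps gens_upto_def[symmetric] by (elim de_Morgan_conj[THEN iffD1, elim_format] disjE) simp_all
  qed
qed

text \<open>
  \<open>l v\<close> and \<open>r v\<close> are the older neighbours of a new vertex \<open>v\<close>; they coincide if \<open>v\<close> has degree one.
\<close>

locale coral_parents =
  fixes N :: "nat \<Rightarrow> nat" and n :: nat and V :: "nat \<Rightarrow> 'v set" and E :: "nat \<Rightarrow> 'v rel"
    and l r :: "'v \<Rightarrow> 'v"
  assumes coral: "coral N n V E"
    and parents: "\<And>k v. k < n \<Longrightarrow> v \<in> V (Suc k) \<Longrightarrow>
      {b. (v, b) \<in> E (Suc k)} = {l v, r v} \<and> (l v = r v \<or> (l v, r v) \<in> E k)"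

lemma coral_disjoint:
  assumes "coral N n V E" "i < j" "j \<le> n"
  shows "V j \<inter> gens_upto V i = {}"
proof -
  obtain k where k: "j = Suc k" "i \<le> k" using assms(2) by (cases j) auto
  then have "V j \<inter> gens_upto V k = {}"
    using coral_SucD(5)[OF coral_le[OF assms(1)]] assms(3) by simp
  then show ?thesis using gens_upto_mono[OF k(2), of V] by auto
qed

lemma coral_gen_unique:
  assumes "coral N n V E" "v \<in> V i" "v \<in> V j" "i \<le> n" "j \<le> n"
  shows "i = j"
proof (rule ccontr)
  have *: False if "v \<in> V i" "v \<in> V j" "j \<le> n" "i < j" for i j
    using coral_disjoint[OF assms(1) that(4,3)] that(1,2) by (auto simp: gens_upto_def)
  assume "i \<noteq> j"
  then show False using *[of i j] *[of j i] assms by (cases "i < j") auto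
qed

lemma ex_coral_parents:
  assumes "coral N n V E"
  shows "\<exists>l r. coral_parents N n V E l r"
proof -
  define P where "P v l r \<longleftrightarrow> (\<forall>k<n. v \<in> V (Suc k) \<longrightarrow>
      {b. (v, b) \<in> E (Suc k)} = {l, r} \<and> (l = r \<or> (l, r) \<in> E k))" for v l r
  have "\<exists>l r. P v l r" for v
  proof (cases "\<exists>k<n. v \<in> V (Suc k)")
    case True
    then obtain k where k: "k < n" "v \<in> V (Suc k)" by blast
    have "coral N (Suc k) V E" using coral_le[OF assms, of "Suc k"] k by simp
    then obtain l r where "{b. (v, b) \<in> E (Suc k)} = {l, r} \<and> (l = r \<or> (l, r) \<in> E k)"
      unfolding coral_Suc_iff using k(2) by blast
    moreover have "k' = k" if "k' < n" "v \<in> V (Suc k')" for k'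
      using coral_gen_unique[OF assms k(2) that(2)] k that by simp
    ultimately have "P v l r" unfolding P_def by blast
    then show ?thesis by blast
  qed (auto simp: P_def)
  then obtain l r where "\<And>v. P v (l v) (r v)" by metis
  then have "coral_parents N n V E l r"
    using assms unfolding P_def by unfold_locales simp_all
  then show ?thesis by blast
qed

context coral_parents
begin

abbreviation G :: "nat \<Rightarrow> 'v set" where "G \<equiv> gens_upto V"

lemma G_mono: "j \<le> k \<Longrightarrow> v \<in> G j \<Longrightarrow> v \<in> G k"
  using gens_upto_mono[of j k V] by blast

lemma in_G: "v \<in> V j \<Longrightarrow> v \<in> G j"
  by (auto simp: gens_upto_def)

lemma edge_sym: "k \<le> n \<Longrightarrow> (a, b) \<in> E k \<Longrightarrow> (b, a) \<in> E k"
  using symD[OF coral_sym[OF coral_le[OF coral]]] .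

lemma edge_verts:
  assumes "k \<le> n" "(a, b) \<in> E k"
  shows "a \<in> G k \<and> b \<in> G k"
  using subsetD[OF coral_edges_subset[OF coral_le[OF coral assms(1)]] assms(2)] by simp

lemma edge_from_new:
  assumes "k < n" "v \<in> V (Suc k)"
  shows "(v, b) \<in> E (Suc k) \<longleftrightarrow> b = l v \<or> b = r v"
  using conjunct1[OF parents[OF assms]] by (simp add: set_eq_iff)

lemma new_notin:
  assumes "k < n" "v \<in> V (Suc k)"
  shows "v \<notin> G k"
  using coral_SucD(5)[OF coral_le[OF coral, of "Suc k"]] assms by auto

lemma edge_Suc:
  assumes "k < n" "(a, b) \<in> E (Suc k)"
  obtains "a \<in> V (Suc k)" "b \<in> G k" "b = l a \<or> b = r a"
    | "b \<in> V (Suc k)" "a \<in> G k" "a = l b \<or> a = r b"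
proof -
  have ba: "(b, a) \<in> E (Suc k)" using edge_sym[OF _ assms(2)] assms(1) by simp
  have "E (Suc k) \<subseteq> V (Suc k) \<times> G k \<union> G k \<times> V (Suc k)"
    using coral_SucD(7)[OF coral_le[OF coral]] assms(1) by simp
  then consider "a \<in> V (Suc k)" "b \<in> G k" | "b \<in> V (Suc k)" "a \<in> G k" using assms(2) by blast
  then show ?thesis
  proof cases
    case 1
    then show ?thesis using that(1) edge_from_new[OF assms(1), of a b] assms(2) by simp
  next
    case 2
    then show ?thesis using that(2) edge_from_new[OF assms(1), of b a] ba by simp
  qed
qed

lemma parents_in_G:
  assumes "k < n" "v \<in> V (Suc k)"
  shows "l v \<in> G k \<and> r v \<in> G k"
proof -
  have "b \<in> G k" if "(v, b) \<in> E (Suc k)" for b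
    by (rule edge_Suc[OF assms(1) that]) (use new_notin[OF assms] in auto)
  then show ?thesis using edge_from_new[OF assms] by simp
qed

lemma gen_cases: "v \<in> G (Suc k) \<Longrightarrow> v \<in> G k \<or> v \<in> V (Suc k)"
  by (auto simp: gens_upto_Suc)

end

section \<open>Separation of points in the geometric realization\<close>

text \<open>
  A point of the geometric realization, on the edge from \<open>a\<close> to \<open>b\<close> at parameter \<open>s\<close>, is identified
  with the functional that evaluates the affine extension of a function on vertices. The same point has
  several descriptions (an edge can be reversed, a vertex lies on many edges), but only one functional.
\<close>

definition edge_point :: "'v \<Rightarrow> 'v \<Rightarrow> real \<Rightarrow> ('v \<Rightarrow> real) \<Rightarrow> real" where
  "edge_point a b s \<phi> = (1 - s) * \<phi> a + s * \<phi> b"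

lemma edge_point_swap: "edge_point a b s = edge_point b a (1 - s)"
  by (simp add: edge_point_def fun_eq_iff)

lemma edge_point_same: "edge_point a a s = edge_point a a t"
  by (simp add: edge_point_def fun_eq_iff algebra_simps)

lemma edge_point_zero: "edge_point a b 0 = edge_point a a 0"
  by (simp add: edge_point_def fun_eq_iff)

lemma edge_point_diff: "edge_point a b s \<phi> - edge_point a b t \<phi> = (s - t) * (\<phi> b - \<phi> a)"
  by (simp add: edge_point_def algebra_simps)

text \<open>
  The data of the embedding: \<open>f\<close> is the map into coordinates, \<open>blk k\<close> the indices of the basis vectors
  of generation \<open>k\<close>, and \<open>z v\<close> the direction in which a vertex of that generation leaves the average of
  its older neighbours.
\<close>

locale coral_coordinates = coral_parents N n V E l r + coord_seminorm q
  for N :: "nat \<Rightarrow> nat" and n :: nat and V :: "nat \<Rightarrow> 'v set" and E :: "nat \<Rightarrow> 'v rel"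
    and l r :: "'v \<Rightarrow> 'v" and q :: "(nat \<Rightarrow> real) \<Rightarrow> real" +
  fixes lam c :: real and blk :: "nat \<Rightarrow> nat set" and z f :: "'v \<Rightarrow> nat \<Rightarrow> real"
  assumes lam: "1/2 < lam" "lam < 1"
    and c: "0 < c" "c \<le> 1"
    and blk_disjoint: "i \<noteq> j \<Longrightarrow> blk i \<inter> blk j = {}"
    and z_supp: "k \<le> n \<Longrightarrow> v \<in> V k \<Longrightarrow> supported_on (blk k) (z v)"
    and z_unit: "k \<le> n \<Longrightarrow> v \<in> V k \<Longrightarrow> q (z v) = 1"
    and z_sep: "k \<le> n \<Longrightarrow> v \<in> V k \<Longrightarrow> w \<in> V k \<Longrightarrow> v \<noteq> w \<Longrightarrow> c \<le> q (\<lambda>i. z v i - z w i)"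
    and f_base: "v \<in> V 0 \<Longrightarrow> f v = z v"
    and f_step: "k < n \<Longrightarrow> v \<in> V (Suc k) \<Longrightarrow>
      f v = (\<lambda>i. (f (l v) i + f (r v) i) / 2 + lam ^ Suc k * z v i)"
begin

lemma z_other_block:
  assumes "k \<le> n" "v \<in> V k" "i \<in> blk j" "j \<noteq> k"
  shows "z v i = 0"
  using z_supp[OF assms(1,2)] blk_disjoint[OF assms(4)] assms(3) by (auto simp: supported_on_def)

lemma f_later_block:
  assumes "k \<le> n" "v \<in> G k" "i \<in> blk j" "k < j"
  shows "f v i = 0"
  using assms
proof (induction k arbitrary: v)
  case 0
  then have "v \<in> V 0" by (simp add: gens_upto_0)
  then show ?case using f_base[of v] z_other_block[of 0 v i j] 0 by simp
next
  case (Suc k)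
  show ?case
  proof (cases "v \<in> G k")
    case True
    then show ?thesis using Suc by simp
  next
    case False
    then have v: "v \<in> V (Suc k)" using Suc.prems(2) gen_cases by blast
    have "f (l v) i = 0" "f (r v) i = 0"
      using Suc.IH[of "l v"] Suc.IH[of "r v"] parents_in_G[of k v] v Suc.prems by simp_all
    then show ?thesis using f_step[of k v] z_other_block[of "Suc k" v i j] v Suc.prems by simp
  qed
qed

lemma f_own_block:
  assumes "j \<le> n" "v \<in> V j" "i \<in> blk j"
  shows "f v i = lam ^ j * z v i"
proof (cases j)
  case 0
  then show ?thesis using f_base assms by simp
next
  case (Suc k)
  then have "f (l v) i = 0" "f (r v) i = 0"
    using f_later_block[of k "l v" i j] f_later_block[of k "r v" i j] parents_in_G[of k v] assms
    by simp_all
  then show ?thesis using f_step[of k v] assms Suc by simp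
qed

text \<open>
  In the blocks of older generations a new vertex sits at the average of its neighbours. Therefore
  the values there do not change under the retraction to older generations.
\<close>

lemma f_harmonic:
  assumes "k < n" "v \<in> V (Suc k)" "i \<in> blk j" "j \<le> k"
  shows "f v i = (f (l v) i + f (r v) i) / 2"
  using f_step[OF assms(1,2)] z_other_block[of "Suc k" v i j] assms by simp

definition edge_at :: "nat \<Rightarrow> 'v \<Rightarrow> 'v \<Rightarrow> bool" where
  "edge_at j a b \<longleftrightarrow> a \<in> G j \<and> b \<in> G j \<and> (a = b \<or> (a, b) \<in> E j)"

text \<open>
  For the shortest path distance these are the functions with Lipschitz constant one. Bounding
  \<open>P \<phi> - Q \<phi>\<close> for all of them is a way to bound the distance of two points of the realization
  without defining it.
\<close>

definition lipschitz :: "('v \<Rightarrow> real) \<Rightarrow> bool" where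
  "lipschitz \<phi> \<longleftrightarrow> (\<forall>k\<le>n. \<forall>a b. (a, b) \<in> E k \<longrightarrow> \<bar>\<phi> a - \<phi> b\<bar> \<le> lam ^ k)"

definition block_diff :: "nat \<Rightarrow> (('v \<Rightarrow> real) \<Rightarrow> real) \<Rightarrow> (('v \<Rightarrow> real) \<Rightarrow> real) \<Rightarrow> real" where
  "block_diff j P Q = q (\<lambda>i. if i \<in> blk j then P (\<lambda>v. f v i) - Q (\<lambda>v. f v i) else 0)"

text \<open>
  The goal of the argument: at some generation \<open>i\<close> the difference of the points is visible in the block,
  on the scale \<open>\<lambda>\<^sup>i\<close> of their distance. The bound on the distance is \<open>2 (\<lambda>\<^sup>i + \<dots> + \<lambda>\<^sup>j)\<close> in closed form: \<open>2 \<lambda>\<^sup>i\<close> at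
  generation \<open>i\<close>, and \<open>2 \<lambda>\<^sup>l\<close> for moving both points by at most \<open>\<lambda>\<^sup>l\<close> at each later generation \<open>l \<le> j\<close>.
\<close>

definition separated :: "nat \<Rightarrow> (('v \<Rightarrow> real) \<Rightarrow> real) \<Rightarrow> (('v \<Rightarrow> real) \<Rightarrow> real) \<Rightarrow> bool" where
  "separated j P Q \<longleftrightarrow> (\<exists>i\<le>j. c / 4 * lam ^ i \<le> block_diff i P Q \<and>
     (\<forall>\<phi>. lipschitz \<phi> \<longrightarrow> P \<phi> - Q \<phi> \<le> 2 / (1 - lam) * (lam ^ i - lam ^ Suc j)))"

definition same_edge :: "nat \<Rightarrow> (('v \<Rightarrow> real) \<Rightarrow> real) \<Rightarrow> (('v \<Rightarrow> real) \<Rightarrow> real) \<Rightarrow> bool" where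
  "same_edge j P Q \<longleftrightarrow> (\<exists>g h t t'. edge_at j g h \<and> t \<in> {0..1} \<and> t' \<in> {0..1} \<and>
     P = edge_point g h t \<and> Q = edge_point g h t')"

text \<open>
  As the parameters stay below \<open>1/2\<close>, more than half of the weight of both points is at the common vertex,
  which is thereby determined by each of them.
\<close>

definition near_vertex :: "nat \<Rightarrow> (('v \<Rightarrow> real) \<Rightarrow> real) \<Rightarrow> (('v \<Rightarrow> real) \<Rightarrow> real) \<Rightarrow> bool" where
  "near_vertex j P Q \<longleftrightarrow> (\<exists>a y y' s s'. edge_at j a y \<and> edge_at j a y' \<and> s \<in> {0..<1/2} \<and> s' \<in> {0..<1/2} \<and>
     P = edge_point a y s \<and> Q = edge_point a y' s')"

text \<open>
  The normal form of a point \<open>P\<close> of generation \<open>j + 1\<close>: it lies on a new edge from an old vertex \<open>x\<close> to a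
  new vertex \<open>b\<close>, or is an old vertex. As the retraction takes \<open>b\<close> to the midpoint of \<open>x\<close> and its other
  neighbour \<open>x2\<close>, it takes \<open>P\<close> to the point \<open>edge_point x x2 (s / 2)\<close>.
\<close>

definition branch :: "nat \<Rightarrow> (('v \<Rightarrow> real) \<Rightarrow> real) \<Rightarrow> 'v \<Rightarrow> 'v \<Rightarrow> 'v \<Rightarrow> real \<Rightarrow> bool" where
  "branch j P x b x2 s \<longleftrightarrow> edge_at j x x2 \<and> s \<in> {0..1} \<and> P = edge_point x b s \<and>
     (b = x \<and> s = 0 \<and> x2 = x \<or> b \<in> V (Suc j) \<and> (x = l b \<and> x2 = r b \<or> x = r b \<and> x2 = l b))"

lemma edge_at_sym: "j \<le> n \<Longrightarrow> edge_at j a b \<Longrightarrow> edge_at j b a"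
  using edge_sym by (auto simp: edge_at_def)

lemma lipschitzD:
  "lipschitz \<phi> \<Longrightarrow> k \<le> n \<Longrightarrow> (a, b) \<in> E k \<Longrightarrow> \<bar>\<phi> a - \<phi> b\<bar> \<le> lam ^ k"
  by (auto simp: lipschitz_def)

lemma lipschitz_edge_at:
  "lipschitz \<phi> \<Longrightarrow> k \<le> n \<Longrightarrow> edge_at k a b \<Longrightarrow> \<bar>\<phi> a - \<phi> b\<bar> \<le> lam ^ k"
  using lam by (auto simp: edge_at_def lipschitzD)

lemma block_diff_cong:
  assumes "\<And>i. i \<in> blk j \<Longrightarrow> P (\<lambda>v. f v i) - Q (\<lambda>v. f v i) = a i" "supported_on (blk j) a"
  shows "block_diff j P Q = q a"
proof -
  have "(\<lambda>i. if i \<in> blk j then P (\<lambda>v. f v i) - Q (\<lambda>v. f v i) else 0) = a"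
    using assms by (auto simp: supported_on_def fun_eq_iff)
  then show ?thesis by (simp add: block_diff_def)
qed

lemma separatedI:
  assumes "c / 4 * lam ^ j \<le> block_diff j P Q"
    and "\<And>\<phi>. lipschitz \<phi> \<Longrightarrow> P \<phi> - Q \<phi> \<le> 2 * lam ^ j"
  shows "separated j P Q"
proof -
  have "2 / (1 - lam) * (lam ^ j - lam ^ Suc j) = 2 * lam ^ j"
    using lam by (simp add: field_simps)
  then show ?thesis unfolding separated_def using assms by (intro exI[of _ j]) auto
qed

lemma branch_edges:
  assumes "branch j P x b x2 s" "j < n"
  shows "edge_at (Suc j) x b" "edge_at (Suc j) x2 b"
proof -
  have "x \<in> G j" "x2 \<in> G j" using assms by (auto simp: branch_def edge_at_def)
  then have G: "x \<in> G (Suc j)" "x2 \<in> G (Suc j)" by (auto simp: gens_upto_Suc)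
  have "b = x \<and> x2 = x \<or> b \<in> G (Suc j) \<and> (b, x) \<in> E (Suc j) \<and> (b, x2) \<in> E (Suc j)"
    using assms edge_from_new[OF assms(2), of b] by (auto simp: branch_def gens_upto_Suc)
  then show "edge_at (Suc j) x b" "edge_at (Suc j) x2 b"
    using G edge_sym[of "Suc j" b] assms(2) by (auto simp: edge_at_def)
qed

lemma branch_lipschitz:
  assumes "branch j P x b x2 s" "j < n" "lipschitz \<phi>"
  shows "\<bar>P \<phi> - edge_point x x2 (s / 2) \<phi>\<bar> \<le> lam ^ Suc j"
proof -
  have "\<bar>\<phi> x - \<phi> b\<bar> \<le> lam ^ Suc j" "\<bar>\<phi> x2 - \<phi> b\<bar> \<le> lam ^ Suc j"
    using branch_edges[OF assms(1,2)] assms(2,3) by (auto intro!: lipschitz_edge_at simp del: power_Suc)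
  then have "\<bar>\<phi> b - (\<phi> x + \<phi> x2) / 2\<bar> \<le> lam ^ Suc j"
    unfolding abs_le_iff by (simp add: field_simps)
  moreover have s: "0 \<le> s" "s \<le> 1" and P: "P = edge_point x b s" using assms(1) by (auto simp: branch_def)
  have eq: "P \<phi> - edge_point x x2 (s / 2) \<phi> = s * (\<phi> b - (\<phi> x + \<phi> x2) / 2)"
    unfolding P by (simp add: edge_point_def algebra_simps)
  ultimately have "s * \<bar>\<phi> b - (\<phi> x + \<phi> x2) / 2\<bar> \<le> 1 * lam ^ Suc j" using s by (intro mult_mono) auto
  then show ?thesis unfolding eq using s by (simp add: abs_mult)
qed

lemma branch_block:
  assumes "branch j P x b x2 s" "j < n" "i \<in> blk k" "k \<le> j"
  shows "P (\<lambda>v. f v i) = edge_point x x2 (s / 2) (\<lambda>v. f v i)"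
proof (cases "b \<in> V (Suc j)")
  case True
  have "f b i = (f x i + f x2 i) / 2"
    using f_harmonic[OF assms(2) True assms(3,4)] assms(1) new_notin[OF assms(2) True]
    by (auto simp: branch_def edge_at_def)
  moreover have "P = edge_point x b s" using assms(1) by (simp add: branch_def)
  ultimately show ?thesis by (simp add: edge_point_def field_simps)
next
  case False
  then show ?thesis using assms(1) by (auto simp: branch_def edge_point_def)
qed

text \<open>
  Separation at an earlier generation persists, since the retraction preserves the earlier blocks and
  moves points of generation \<open>j + 1\<close> by at most \<open>\<lambda> ^ (j + 1)\<close>.
\<close>

lemma separated_lift:
  assumes "separated j (edge_point x x2 (s / 2)) (edge_point y y2 (t / 2))" "j < n"
    and "branch j P x b x2 s" "branch j Q y b' y2 t"
  shows "separated (Suc j) P Q"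
proof -
  obtain i where i: "i \<le> j" "c / 4 * lam ^ i \<le> block_diff i (edge_point x x2 (s / 2)) (edge_point y y2 (t / 2))"
    and *: "\<And>\<phi>. lipschitz \<phi> \<Longrightarrow> edge_point x x2 (s / 2) \<phi> - edge_point y y2 (t / 2) \<phi> \<le> 2 / (1 - lam) * (lam ^ i - lam ^ Suc j)"
    using assms(1) unfolding separated_def by blast
  have "block_diff i P Q = block_diff i (edge_point x x2 (s / 2)) (edge_point y y2 (t / 2))"
    unfolding block_diff_def using branch_block[OF assms(3,2) _ i(1)] branch_block[OF assms(4,2) _ i(1)]
    by (intro arg_cong[of _ _ q]) (simp add: fun_eq_iff)
  moreover have "P \<phi> - Q \<phi> \<le> 2 / (1 - lam) * (lam ^ i - lam ^ Suc (Suc j))" if "lipschitz \<phi>" for \<phi>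
  proof -
    have "P \<phi> - Q \<phi> \<le> 2 / (1 - lam) * (lam ^ i - lam ^ Suc j) + 2 * lam ^ Suc j"
      using *[OF that] branch_lipschitz[OF assms(3,2) that] branch_lipschitz[OF assms(4,2) that] by linarith
    also have "2 * lam ^ Suc j = 2 / (1 - lam) * (lam ^ Suc j - lam ^ Suc (Suc j))"
      using lam by (simp add: field_simps)
    finally show ?thesis by (simp add: ring_distribs)
  qed
  ultimately show ?thesis unfolding separated_def using i by (intro exI[of _ i]) auto
qed

text \<open>
  The own block of an edge sees only its younger end, or the separated directions of both ends
  for the edge of generation zero.
\<close>

lemma edge_block:
  assumes "j \<le> n" "edge_at j g h" "g \<noteq> h"
  shows "\<exists>u. c \<le> q u \<and> supported_on (blk j) u \<and> (\<forall>i\<in>blk j. f h i - f g i = lam ^ j * u i)"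
proof (cases j)
  case 0
  then have "g \<in> V 0" "h \<in> V 0" using assms(2) by (auto simp: edge_at_def gens_upto_0)
  then show ?thesis
    using z_sep[of 0 h g] assms z_supp[of 0 h] z_supp[of 0 g] f_base 0
    by (intro exI[of _ "\<lambda>i. z h i - z g i"]) (auto simp: supported_on_def)
next
  case (Suc k)
  then have k: "k < n" and e: "(g, h) \<in> E (Suc k)" using assms by (auto simp: edge_at_def)
  show ?thesis
  proof (rule edge_Suc[OF k e])
    assume "g \<in> V (Suc k)" "h \<in> G k"
    then show ?thesis
      using Suc assms(1) c z_unit[of j g] z_supp[of j g] f_own_block[of j g] f_later_block[of k h _ j]
      by (intro exI[of _ "\<lambda>i. - z g i"]) (auto simp: supported_on_def minus)
  next
    assume "h \<in> V (Suc k)" "g \<in> G k"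
    then show ?thesis
      using Suc assms(1) c z_unit[of j h] z_supp[of j h] f_own_block[of j h] f_later_block[of k g _ j]
      by (intro exI[of _ "z h"]) (auto simp: supported_on_def)
  qed
qed

lemma edge_separated:
  assumes "j \<le> n" "edge_at j g h" "g \<noteq> h" "t \<in> {0..1}" "t' \<in> {0..1}" "1/4 \<le> \<bar>t - t'\<bar>"
  shows "separated j (edge_point g h t) (edge_point g h t')"
proof (rule separatedI)
  obtain u where u: "c \<le> q u" "supported_on (blk j) u" "\<forall>i\<in>blk j. f h i - f g i = lam ^ j * u i"
    using edge_block[OF assms(1-3)] by blast
  have "block_diff j (edge_point g h t) (edge_point g h t') = q (\<lambda>i. ((t - t') * lam ^ j) * u i)"
    by (rule block_diff_cong) (use u in \<open>auto simp: edge_point_diff supported_on_def\<close>)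
  also have "\<dots> = (\<bar>t - t'\<bar> * q u) * lam ^ j" using lam by (simp add: hom abs_mult)
  finally have bd: "block_diff j (edge_point g h t) (edge_point g h t') = (\<bar>t - t'\<bar> * q u) * lam ^ j" .
  have "1/4 * c \<le> \<bar>t - t'\<bar> * q u" using assms(6) u(1) c by (intro mult_mono) auto
  then show "c / 4 * lam ^ j \<le> block_diff j (edge_point g h t) (edge_point g h t')"
    unfolding bd using lam by (intro mult_right_mono) auto
next
  fix \<phi> assume "lipschitz \<phi>"
  then have d: "\<bar>\<phi> h - \<phi> g\<bar> \<le> lam ^ j"
    using lipschitz_edge_at[OF _ assms(1,2)] by (simp add: abs_minus_commute)
  have "edge_point g h t \<phi> - edge_point g h t' \<phi> \<le> \<bar>t - t'\<bar> * \<bar>\<phi> h - \<phi> g\<bar>"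
    unfolding edge_point_diff by (simp flip: abs_mult)
  also have "\<dots> \<le> 1 * lam ^ j" using assms d by (intro mult_mono) auto
  also have "\<dots> \<le> 2 * lam ^ j" using lam by simp
  finally show "edge_point g h t \<phi> - edge_point g h t' \<phi> \<le> 2 * lam ^ j" .
qed

text \<open>
  Old vertices vanish in the block of generation \<open>j + 1\<close>, so the two points appear there as points on the
  rays of \<open>z b\<close> and \<open>z b'\<close>.
\<close>

lemma branches_block:
  assumes "branch j P x b x2 s" "branch j Q y b' y2 s'" "b \<noteq> b'" "j < n"
    and "b \<in> V (Suc j) \<or> b' \<in> V (Suc j)"
  shows "c / 2 * max s s' * lam ^ Suc j \<le> block_diff (Suc j) P Q"
proof -
  note b_ne = assms(3)
  have xy: "x \<in> G j" "y \<in> G j" and s: "0 \<le> s" "0 \<le> s'" and PQ: "P = edge_point x b s" "Q = edge_point y b' s'"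
    using assms by (auto simp: branch_def edge_at_def)
  have f_x: "f x i = 0" and f_y: "f y i = 0" if "i \<in> blk (Suc j)" for i
    using f_later_block[of j _ i "Suc j"] xy assms(4) that by simp_all
  define u where "u b = (if b \<in> V (Suc j) then z b else (\<lambda>i. 0))" for b
  have u_supp: "supported_on (blk (Suc j)) (u b)" for b
    using z_supp assms(4) by (simp add: u_def)
  have u_f: "t * f w i = lam ^ Suc j * (t * u w i)"
    if "i \<in> blk (Suc j)" "w \<in> V (Suc j) \<or> t = 0" for w t i
    using that f_own_block[of "Suc j" w i] assms(4) by (auto simp: u_def)
  have new: "b \<in> V (Suc j) \<or> s = 0 \<and> b = x" "b' \<in> V (Suc j) \<or> s' = 0 \<and> b' = y"
    using assms(1,2) by (auto simp: branch_def)
  have "block_diff (Suc j) P Q = q (\<lambda>i. lam ^ Suc j * (s * u b i - s' * u b' i))"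
  proof (rule block_diff_cong)
    fix i assume i: "i \<in> blk (Suc j)"
    have "s * f b i = lam ^ Suc j * (s * u b i)" "s' * f b' i = lam ^ Suc j * (s' * u b' i)"
      using u_f[OF i] new by blast+
    then show "P (\<lambda>v. f v i) - Q (\<lambda>v. f v i) = lam ^ Suc j * (s * u b i - s' * u b' i)"
      unfolding PQ edge_point_def
      by (simp only: f_x[OF i] f_y[OF i] right_diff_distrib mult_zero_right add_0)
  qed (use u_supp in \<open>auto simp: supported_on_def\<close>)
  also have "\<dots> = q (\<lambda>i. s * u b i - s' * u b' i) * lam ^ Suc j"
    unfolding hom using lam by simp
  finally have eq: "block_diff (Suc j) P Q = q (\<lambda>i. s * u b i - s' * u b' i) * lam ^ Suc j" .
  have "c / 2 * max s s' \<le> q (\<lambda>i. s * u b i - s' * u b' i)"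
  proof (cases "b \<in> V (Suc j) \<and> b' \<in> V (Suc j)")
    case True
    then show ?thesis
      using z_unit[of "Suc j"] z_sep[of "Suc j" b b'] b_ne assms(4) s
      by (intro separated_rays) (auto simp: u_def)
  next
    case False
    have *: "c / 2 * t \<le> t" if "0 \<le> t" for t using mult_right_mono[of c 1 t] c that by simp
    show ?thesis
    proof (cases "b \<in> V (Suc j)")
      case True
      then have "s' = 0" "q (u b) = 1" using False new z_unit[of "Suc j" b] assms(4) by (auto simp: u_def)
      then show ?thesis using * s by (simp add: hom)
    next
      case nb: False
      then have "s = 0" "b' \<in> V (Suc j)" using new assms(5) by auto
      moreover have "q (u b') = 1" using calculation z_unit[of "Suc j" b'] assms(4) by (auto simp: u_def)
      ultimately show ?thesis using * s by (simp add: hom minus)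
    qed
  qed
  then show ?thesis unfolding eq using lam by (intro mult_right_mono) auto
qed

lemma edge_point_le:
  assumes "s \<in> {0..1}" "\<phi> a \<le> M" "\<phi> b \<le> M"
  shows "edge_point a b s \<phi> \<le> (M::real)"
proof -
  have "edge_point a b s \<phi> \<le> (1 - s) * M + s * M"
    unfolding edge_point_def using assms by (intro add_mono mult_left_mono) auto
  then show ?thesis by (simp add: algebra_simps)
qed

lemma branches_separated:
  assumes "branch j P x b x2 s" "branch j Q y b' y2 s'" "j < n" "b \<noteq> b'" "1/2 \<le> max s s'"
    and close: "\<And>\<phi> u w. lipschitz \<phi> \<Longrightarrow> u \<in> {x, b} \<Longrightarrow> w \<in> {y, b'} \<Longrightarrow> \<phi> u - \<phi> w \<le> 2 * lam ^ Suc j"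
  shows "separated (Suc j) P Q"
proof (rule separatedI)
  have s: "s \<in> {0..1}" "s' \<in> {0..1}" and PQ: "P = edge_point x b s" "Q = edge_point y b' s'"
    and new: "b \<in> V (Suc j) \<or> b' \<in> V (Suc j)"
    using assms(1,2,5) by (auto simp: branch_def)
  have "c / 2 * (1/2) \<le> c / 2 * max s s'" using assms(5) c by (intro mult_left_mono) auto
  then have "c / 2 * (1/2) * lam ^ Suc j \<le> c / 2 * max s s' * lam ^ Suc j"
    using lam by (intro mult_right_mono) auto
  then show "c / 4 * lam ^ Suc j \<le> block_diff (Suc j) P Q"
    using branches_block[OF assms(1,2,4,3) new] by simp
  fix \<phi> assume lip: "lipschitz \<phi>"
  have "P \<phi> \<le> \<phi> w + 2 * lam ^ Suc j" if "w \<in> {y, b'}" for w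
    unfolding PQ using close[OF lip _ that, of x] close[OF lip _ that, of b] s(1)
    by (intro edge_point_le) (auto simp: algebra_simps)
  then have "edge_point y b' s' (\<lambda>v. - \<phi> v) \<le> 2 * lam ^ Suc j - P \<phi>"
    using s(2) by (intro edge_point_le) (auto simp: algebra_simps)
  then show "P \<phi> - Q \<phi> \<le> 2 * lam ^ Suc j"
    unfolding PQ by (simp add: edge_point_def algebra_simps)
qed

text \<open>
  Two points that leave an old vertex \<open>x\<close> are on one edge, or on different edges. In the second case they
  are separated as soon as one of them is half way from \<open>x\<close>, because different new vertices have
  separated directions.
\<close>

lemma branches_from_vertex:
  assumes "branch j P x b x2 s" "branch j Q x b' x2' s'" "j < n"
  shows "separated (Suc j) P Q \<or> same_edge (Suc j) P Q \<or> near_vertex (Suc j) P Q"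
proof -
  have s: "0 \<le> s" "s \<le> 1" "0 \<le> s'" "s' \<le> 1" and PQ: "P = edge_point x b s" "Q = edge_point x b' s'"
    using assms by (auto simp: branch_def)
  note e = branch_edges(1)[OF assms(1,3)] branch_edges(1)[OF assms(2,3)]
  consider "b = b'" | "b \<noteq> b'" "max s s' < 1/2" | "b \<noteq> b'" "1/2 \<le> max s s'" by fastforce
  then show ?thesis
  proof cases
    case 1
    then have "same_edge (Suc j) P Q"
      unfolding same_edge_def using e s PQ by (intro exI[of _ x] exI[of _ b] exI[of _ s] exI[of _ s']) auto
    then show ?thesis by blast
  next
    case 2
    then have "near_vertex (Suc j) P Q"
      unfolding near_vertex_def using e s PQ
      by (intro exI[of _ x] exI[of _ b] exI[of _ b'] exI[of _ s] exI[of _ s']) auto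
    then show ?thesis by blast
  next
    case 3
    have "separated (Suc j) P Q"
    proof (rule branches_separated[OF assms 3])
      fix \<phi> u w assume "lipschitz \<phi>" "u \<in> {x, b}" "w \<in> {x, b'}"
      moreover have "\<bar>\<phi> x - \<phi> b\<bar> \<le> lam ^ Suc j" "\<bar>\<phi> x - \<phi> b'\<bar> \<le> lam ^ Suc j"
        using e \<open>lipschitz \<phi>\<close> assms(3) by (auto intro!: lipschitz_edge_at simp del: power_Suc)
      moreover have "0 \<le> lam ^ Suc j" using lam by simp
      ultimately show "\<phi> u - \<phi> w \<le> 2 * lam ^ Suc j"
        by (elim insertE emptyE) (simp_all del: power_Suc)
    qed
    then show ?thesis by blast
  qed
qed

lemma ex_branch:
  assumes "j < n" "edge_at (Suc j) a y" "s \<in> {0..1}"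
  shows "\<exists>x b x2 t. branch j (edge_point a y s) x b x2 t"
proof -
  have *: "\<exists>x' b' x2 t'. branch j (edge_point b x t) x' b' x2 t'"
    if "b \<in> V (Suc j)" "x = l b \<or> x = r b" "t \<in> {0..1}" for b x t
  proof -
    have e: "edge_at j (l b) (r b)" 
      using parents[OF assms(1) that(1)] parents_in_G[OF assms(1) that(1)] by (simp add: edge_at_def)
    moreover have "edge_at j (r b) (l b)" using edge_at_sym[OF _ e] assms(1) by simp
    ultimately have "branch j (edge_point b x t) x b (if x = l b then r b else l b) (1 - t)"
      using that edge_point_swap[of b x t] by (auto simp: branch_def)
    then show ?thesis by blast
  qed
  show ?thesis
  proof (cases "a = y")
    case True
    then show ?thesis
    proof (cases "a \<in> G j")
      case aG: True
      have "branch j (edge_point a y s) a a a 0"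
        using aG True edge_point_same[of a s 0] by (auto simp: branch_def edge_at_def)
      then show ?thesis by blast
    next
      case False
      then have a: "a \<in> V (Suc j)" using assms(2) gen_cases by (auto simp: edge_at_def)
      have "edge_point a y s = edge_point a (l a) 0" using True edge_point_same[of a s 0] edge_point_zero[of a "l a"] by simp
      then show ?thesis using *[OF a, of "l a" 0] by simp
    qed
  next
    case False
    then have e: "(a, y) \<in> E (Suc j)" using assms(2) by (simp add: edge_at_def)
    show ?thesis
    proof (rule edge_Suc[OF assms(1) e])
      assume "a \<in> V (Suc j)" "y = l a \<or> y = r a"
      then show ?thesis using * assms(3) by blast
    next
      assume "y \<in> V (Suc j)" "a = l y \<or> a = r y"
      then show ?thesis using *[of y a "1 - s"] assms(3) edge_point_swap[of a y s] by simp
    qed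
  qed
qed

definition ind :: "'v \<Rightarrow> 'v \<Rightarrow> real" where
  "ind x v = (if v = x then 1 else 0)"

text \<open>
  The retraction of a point of generation \<open>j + 1\<close> is at least as close to \<open>x\<close> as to \<open>x2\<close>. Testing against
  the indicator of a vertex reads off its weight, which identifies \<open>x\<close> in any other description of the
  retraction.
\<close>

lemma branch_major:
  assumes "branch j P x b x2 s"
  shows "1/2 \<le> edge_point x x2 (s / 2) (ind x)"
  using assms by (auto simp: branch_def edge_point_def ind_def)

text \<open>
  Two points whose retractions lie on one edge, in the halves of different ends. If the retractions are at
  least a quarter of the edge apart, the block of the edge separates them. Otherwise both are near the
  midpoint of the edge, so the points are near the new vertices \<open>b\<close> and \<open>b'\<close> over this midpoint: if
  these differ, they are separated; if not, the points lie near this vertex on the edges to its two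
  neighbours.
\<close>

lemma branches_opposite:
  assumes P: "branch j P x b x2 s" and Q: "branch j Q y b' y2 s'" and "j < n"
    and "edge_at j x y" "x \<noteq> y" "t \<in> {0..1}" "t' \<in> {0..1}"
    and eq: "edge_point x x2 (s / 2) = edge_point x y t" "edge_point y y2 (s' / 2) = edge_point x y t'"
  shows "separated (Suc j) P Q \<or> near_vertex (Suc j) P Q"
proof (cases "1/4 \<le> \<bar>t - t'\<bar>")
  case True
  then have "separated j (edge_point x x2 (s / 2)) (edge_point y y2 (s' / 2))"
    unfolding eq using assms by (intro edge_separated) auto
  then show ?thesis using separated_lift[OF _ assms(3) P Q] by blast
next
  case False
  have "1/2 \<le> edge_point x y t (ind x)" "1/2 \<le> edge_point x y t' (ind y)"
    using branch_major[OF P] branch_major[OF Q] unfolding eq .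
  then have "t \<le> 1/2" "1/2 \<le> t'" using assms(5) by (simp_all add: edge_point_def ind_def)
  then have t: "1/4 < t" "t' < 3/4" using False by linarith+
  have "s / 2 * ind y x2 = t" "s' / 2 * ind x y2 = 1 - t'"
    using fun_cong[OF eq(1), of "ind y"] fun_cong[OF eq(2), of "ind x"] assms(5)
    by (simp_all add: edge_point_def ind_def)
  then have s: "x2 = y" "1/2 < s" "y2 = x" "1/2 < s'"
    using t by (simp_all add: ind_def split: if_splits)
  have PQ: "P = edge_point x b s" "Q = edge_point y b' s'" "s \<le> 1" "s' \<le> 1" using P Q by (auto simp: branch_def)
  note e = branch_edges[OF P assms(3)] branch_edges[OF Q assms(3)]
  show ?thesis
  proof (cases "b = b'")
    case True
    have "edge_at (Suc j) b x" "edge_at (Suc j) b y"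
      using edge_at_sym[OF _ e(1)] edge_at_sym[OF _ e(3)] True assms(3) by simp_all
    then have "near_vertex (Suc j) P Q"
      unfolding near_vertex_def using True s PQ edge_point_swap[of x b s] edge_point_swap[of y b' s']
      by (intro exI[of _ b] exI[of _ x] exI[of _ y] exI[of _ "1 - s"] exI[of _ "1 - s'"]) auto
    then show ?thesis by blast
  next
    case False
    have "separated (Suc j) P Q"
    proof (rule branches_separated[OF P Q assms(3) False])
      show "1/2 \<le> max s s'" using s by simp
      fix \<phi> u w assume "lipschitz \<phi>" "u \<in> {x, b}" "w \<in> {y, b'}"
      moreover have "\<bar>\<phi> x - \<phi> b\<bar> \<le> lam ^ Suc j" "\<bar>\<phi> y - \<phi> b\<bar> \<le> lam ^ Suc j"
        "\<bar>\<phi> x - \<phi> b'\<bar> \<le> lam ^ Suc j" "\<bar>\<phi> y - \<phi> b'\<bar> \<le> lam ^ Suc j"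
        using e s \<open>lipschitz \<phi>\<close> assms(3) by (auto intro!: lipschitz_edge_at simp del: power_Suc)
      moreover have "0 \<le> lam ^ Suc j" using lam by simp
      ultimately show "\<phi> u - \<phi> w \<le> 2 * lam ^ Suc j"
        unfolding abs_le_iff by (elim insertE emptyE conjE) (simp_all del: power_Suc)
    qed
    then show ?thesis by blast
  qed
qed

text \<open>
  If two retractions are near a common vertex, this vertex is the starting point of both branches. If they
  are on a common edge, the branches start at its ends. So only \<open>branches_opposite\<close> is left when the
  branches start at different vertices.
\<close>

lemma trichotomy_step:
  assumes P: "branch j P x b x2 s" and Q: "branch j Q y b' y2 s'" and "j < n"
    and "separated j (edge_point x x2 (s / 2)) (edge_point y y2 (s' / 2)) \<or>
      same_edge j (edge_point x x2 (s / 2)) (edge_point y y2 (s' / 2)) \<or>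
      near_vertex j (edge_point x x2 (s / 2)) (edge_point y y2 (s' / 2))"
  shows "separated (Suc j) P Q \<or> same_edge (Suc j) P Q \<or> near_vertex (Suc j) P Q"
proof (cases "x = y")
  case True
  then show ?thesis using branches_from_vertex P Q assms(3) by blast
next
  case False
  note major = branch_major[OF P] branch_major[OF Q]
  from assms(4) show ?thesis
  proof (elim disjE)
    assume "separated j (edge_point x x2 (s / 2)) (edge_point y y2 (s' / 2))"
    then show ?thesis using separated_lift[OF _ assms(3) P Q] by blast
  next
    assume "same_edge j (edge_point x x2 (s / 2)) (edge_point y y2 (s' / 2))"
    then obtain g h t t' where gh: "edge_at j g h" "t \<in> {0..1}" "t' \<in> {0..1}"
      and eq: "edge_point x x2 (s / 2) = edge_point g h t" "edge_point y y2 (s' / 2) = edge_point g h t'"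
      unfolding same_edge_def by blast
    have "x = g \<or> x = h" "y = g \<or> y = h"
      using major unfolding eq by (auto simp: edge_point_def ind_def split: if_splits)
    then consider "x = g" "y = h" | "x = h" "y = g" using False by blast
    then show ?thesis
    proof cases
      case 1
      then show ?thesis
        using branches_opposite[OF P Q assms(3) _ False gh(2,3)] gh(1) eq by auto
    next
      case 2
      have "edge_at j x y" using 2 gh(1) edge_at_sym[of j g h] assms(3) by simp
      moreover have "1 - t \<in> {0..1}" "1 - t' \<in> {0..1}" using gh(2,3) by auto
      moreover have "edge_point x x2 (s / 2) = edge_point x y (1 - t)" "edge_point y y2 (s' / 2) = edge_point x y (1 - t')"
        unfolding eq using edge_point_swap[of g h t] edge_point_swap[of g h t'] 2 by simp_all
      ultimately show ?thesis using branches_opposite[OF P Q assms(3) _ False] by blast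
    qed
  next
    assume "near_vertex j (edge_point x x2 (s / 2)) (edge_point y y2 (s' / 2))"
    then obtain a d d' t t' where "t < 1/2" "t' < 1/2" "0 \<le> t" "0 \<le> t'"
      and eq: "edge_point x x2 (s / 2) = edge_point a d t" "edge_point y y2 (s' / 2) = edge_point a d' t'"
      unfolding near_vertex_def by auto
    then have "x = a" "y = a"
      using major unfolding eq by (auto simp: edge_point_def ind_def split: if_splits)
    then show ?thesis using False by simp
  qed
qed

text \<open>
  At generation zero all points lie on the only edge; afterwards the normal form of both points reduces the
  claim to their retractions.
\<close>

lemma trichotomy:
  assumes "j \<le> n" "edge_at j a y" "s \<in> {0..1}" "edge_at j a' y'" "s' \<in> {0..1}"
  shows "separated j (edge_point a y s) (edge_point a' y' s') \<or> same_edge j (edge_point a y s) (edge_point a' y' s') \<or>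
    near_vertex j (edge_point a y s) (edge_point a' y' s')"
  using assms
proof (induction j arbitrary: a y s a' y' s')
  case 0
  obtain v0 v1 where V: "V 0 = {v0, v1}" "E 0 = {(v0, v1), (v1, v0)}"
    using coral_le[OF coral, of 0] by auto
  have *: "\<exists>t\<in>{0..1}. edge_point a y s = edge_point v0 v1 t" if "edge_at 0 a y" "s \<in> {0..1}" for a y s
  proof -
    have "a \<in> {v0, v1}" "y \<in> {v0, v1}" using that V by (auto simp: edge_at_def gens_upto_0)
    then consider "a = v0" "y = v0" | "a = v0" "y = v1" | "a = v1" "y = v0" | "a = v1" "y = v1" by blast
    then show ?thesis
    proof cases
      case 1
      then show ?thesis using edge_point_same[of v0 s 0] edge_point_zero[of v0 v1] by (intro bexI[of _ 0]) auto
    next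
      case 2
      then show ?thesis using that(2) by blast
    next
      case 3
      then show ?thesis using that(2) edge_point_swap[of v1 v0 s] by (intro bexI[of _ "1 - s"]) auto
    next
      case 4
      then show ?thesis
        using edge_point_same[of v1 s 0] edge_point_zero[of v1 v0] edge_point_swap[of v1 v0 0] by (intro bexI[of _ 1]) auto
    qed
  qed
  obtain t t' where "t \<in> {0..1}" "edge_point a y s = edge_point v0 v1 t" "t' \<in> {0..1}" "edge_point a' y' s' = edge_point v0 v1 t'"
    using *[OF 0(2,3)] *[OF 0(4,5)] by blast
  moreover have "edge_at 0 v0 v1" using V by (simp add: edge_at_def gens_upto_0)
  ultimately show ?case unfolding same_edge_def by blast
next
  case (Suc j)
  have j: "j < n" using Suc.prems(1) by simp
  obtain x b x2 t where P: "branch j (edge_point a y s) x b x2 t" using ex_branch[OF j Suc.prems(2,3)] by blast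
  obtain x' b' x2' t' where Q: "branch j (edge_point a' y' s') x' b' x2' t'" using ex_branch[OF j Suc.prems(4,5)] by blast
  show ?case
  proof (rule trichotomy_step[OF P Q j], rule Suc.IH)
    show "edge_at j x x2" "t / 2 \<in> {0..1}" "edge_at j x' x2'" "t' / 2 \<in> {0..1}"
      using P Q by (auto simp: branch_def)
  qed (use j in simp)
qed

text \<open>
  For two vertices, the other two cases of the trichotomy are void or lead to separation as well: on an edge
  they are its ends, and near a vertex (with a parameter below \<open>1/2\<close>) they both coincide with it.
\<close>

lemma vertices_separated:
  assumes "u \<in> G n" "v \<in> G n" "u \<noteq> v"
  shows "\<exists>i\<le>n. c / 4 * lam ^ i \<le> q (\<lambda>k. if k \<in> blk i then f u k - f v k else 0) \<and>
    (\<forall>\<phi>. lipschitz \<phi> \<longrightarrow> \<phi> u - \<phi> v \<le> 2 / (1 - lam) * lam ^ i)"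
proof -
  have "edge_at n u u" "edge_at n v v" using assms by (auto simp: edge_at_def)
  then have "separated n (edge_point u u 0) (edge_point v v 0) \<or> same_edge n (edge_point u u 0) (edge_point v v 0) \<or>
      near_vertex n (edge_point u u 0) (edge_point v v 0)" by (intro trichotomy) auto
  then have "separated n (edge_point u u 0) (edge_point v v 0)"
  proof (elim disjE)
    assume "same_edge n (edge_point u u 0) (edge_point v v 0)"
    then obtain g h t t' where gh: "edge_at n g h" "t \<in> {0..1}" "t' \<in> {0..1}"
      and eq: "edge_point u u 0 = edge_point g h t" "edge_point v v 0 = edge_point g h t'"
      unfolding same_edge_def by blast
    have "edge_point g h t (ind u) = 1" "edge_point g h t' (ind u) = 0" unfolding eq[symmetric] using assms(3) by (auto simp: edge_point_def ind_def)
    then have "g \<noteq> h" "1/4 \<le> \<bar>t - t'\<bar>" by (auto simp: edge_point_def ind_def split: if_splits)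
    then show ?thesis unfolding eq using gh by (intro edge_separated) auto
  next
    assume "near_vertex n (edge_point u u 0) (edge_point v v 0)"
    then obtain a d d' t t' where t: "t < 1/2" "t' < 1/2" "0 \<le> t" "0 \<le> t'"
      and eq: "edge_point u u 0 = edge_point a d t" "edge_point v v 0 = edge_point a d' t'"
      unfolding near_vertex_def by auto
    have "1/2 < edge_point a d t (ind a)" "1/2 < edge_point a d' t' (ind a)" using t by (auto simp: edge_point_def ind_def)
    then have "u = a" "v = a" unfolding eq[symmetric] by (auto simp: edge_point_def ind_def split: if_splits)
    then show ?thesis using assms(3) by simp
  qed
  then obtain i where i: "i \<le> n" "c / 4 * lam ^ i \<le> block_diff i (edge_point u u 0) (edge_point v v 0)"
    and *: "\<And>\<phi>. lipschitz \<phi> \<Longrightarrow> \<phi> u - \<phi> v \<le> 2 / (1 - lam) * (lam ^ i - lam ^ Suc n)"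
    unfolding separated_def by (auto simp: edge_point_def)
  have "\<phi> u - \<phi> v \<le> 2 / (1 - lam) * lam ^ i" if "lipschitz \<phi>" for \<phi>
  proof -
    have "2 / (1 - lam) * (lam ^ i - lam ^ Suc n) \<le> 2 / (1 - lam) * lam ^ i"
      using lam by (intro mult_left_mono) auto
    then show ?thesis using *[OF that] by linarith
  qed
  moreover have "block_diff i (edge_point u u 0) (edge_point v v 0) = q (\<lambda>k. if k \<in> blk i then f u k - f v k else 0)"
    unfolding block_diff_def edge_point_def by (simp cong: if_cong)
  ultimately show ?thesis using i by (intro exI[of _ i]) simp
qed

text \<open>
  The induction works because \<open>A = 2 \<lambda> / (2 \<lambda> - 1)\<close> satisfies \<open>A / 2 + \<lambda> = A \<lambda>\<close>.
\<close>

lemma f_edge_le: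
  assumes "k \<le> n" "(a, b) \<in> E k"
  shows "q (\<lambda>i. f a i - f b i) \<le> 2 * lam / (2 * lam - 1) * lam ^ k"
  using assms
proof (induction k arbitrary: a b)
  case 0
  then have ab: "a \<in> V 0" "b \<in> V 0" using edge_verts[of 0 a b] by (auto simp: gens_upto_0)
  have "q (\<lambda>i. f a i - f b i) \<le> q (f a) + q (f b)" by (rule diff_le)
  also have "\<dots> = 2" using ab f_base z_unit[of 0] by simp
  also have "2 \<le> 2 * lam / (2 * lam - 1) * lam ^ 0" using lam by (simp add: field_simps)
  finally show ?case .
next
  case (Suc k)
  define A where "A = 2 * lam / (2 * lam - 1)"
  have A: "A / 2 + lam = A * lam" "0 \<le> A" using lam by (auto simp: A_def field_simps)
  have k: "k < n" using Suc.prems by simp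
  have *: "q (\<lambda>i. f a i - f b i) \<le> A * lam ^ Suc k"
    if a: "a \<in> V (Suc k)" and b: "b = l a \<or> b = r a" for a b
  proof -
    define b' where "b' = (if b = l a then r a else l a)"
    have "b = b' \<or> (b, b') \<in> E k" using parents[OF k a] b edge_sym[of k "l a" "r a"] k by (auto simp: b'_def)
    then have bb: "q (\<lambda>i. f b' i - f b i) \<le> A * lam ^ k"
      using Suc.IH[of b b'] k A lam diff_swap[of "f b'" "f b"] by (auto simp: A_def)
    have "f a i - f b i = (1/2) * (f b' i - f b i) + lam ^ Suc k * z a i" for i
      using f_step[OF k a] b by (auto simp: b'_def field_simps)
    then have "q (\<lambda>i. f a i - f b i) \<le> q (\<lambda>i. (1/2) * (f b' i - f b i)) + q (\<lambda>i. lam ^ Suc k * z a i)"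
      using sub[of "\<lambda>i. (1/2) * (f b' i - f b i)" "\<lambda>i. lam ^ Suc k * z a i"] by simp
    also have "\<dots> \<le> (1/2) * (A * lam ^ k) + lam ^ Suc k"
      unfolding hom using z_unit[of "Suc k" a] a k bb lam by simp
    also have "\<dots> = (A / 2 + lam) * lam ^ k" by (simp add: algebra_simps)
    also have "\<dots> = A * lam ^ Suc k" by (simp add: A(1))
    finally show ?thesis .
  qed
  show ?case
    by (rule edge_Suc[OF k Suc.prems(2)])
      (use *[of a b] *[of b a] diff_swap[of "f a" "f b"] in \<open>simp_all add: A_def\<close>)
qed

end

section \<open>The shortest path distance of a coral\<close>

lemma pverts_coral_graph: "pverts (coral_graph V E n) = gens_upto V n"
  by (simp add: coral_graph_def gens_upto_def)

lemma coral_weight_eq: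
  assumes "coral N n V E" "k \<le> n" "e \<in> E k"
  shows "coral_weight lam E e = lam ^ k"
proof -
  have "k \<le> i" if "e \<in> E i" for i
  proof (rule ccontr)
    assume "\<not> k \<le> i"
    then have i: "i < k" by simp
    then obtain m where k: "k = Suc m" by (cases k) auto
    have "fst e \<in> V k \<or> snd e \<in> V k"
      using coral_SucD(7)[OF coral_le[OF assms(1), of "Suc m"]] assms(2,3) k by auto
    moreover have "fst e \<in> gens_upto V i" "snd e \<in> gens_upto V i"
      using coral_edges_subset[OF coral_le[OF assms(1), of i]] i assms(2) that by auto
    ultimately show False using coral_disjoint[OF assms(1) i assms(2)] by auto
  qed
  then have "(LEAST i. e \<in> E i) = k" using assms(3) by (intro Least_equality)
  then show ?thesis by (simp add: coral_weight_def)
qed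

lemma coral_graph_fin:
  assumes "coral N n V E"
  shows "fin_digraph (with_proj (coral_graph V E n))"
proof -
  have sub: "(\<Union>i\<le>n. E i) \<subseteq> gens_upto V n \<times> gens_upto V n"
  proof (rule UN_least)
    fix i assume "i \<in> {..n}"
    then show "E i \<subseteq> gens_upto V n \<times> gens_upto V n"
      using coral_edges_subset[OF coral_le[OF assms, of i]] gens_upto_mono[of i n V] by auto
  qed
  have fin: "finite (gens_upto V n)" using coral_finite[OF assms] .
  then have "finite (\<Union>i\<le>n. E i)" using finite_subset[OF sub] by simp
  then show ?thesis
    using sub fin by unfold_locales (auto simp: coral_graph_def simp flip: gens_upto_def)
qed

context coral_parents
begin

interpretation gr: fin_digraph "with_proj (coral_graph V E n)"
  using coral_graph_fin[OF coral] .

lemma arcs_graph: "e \<in> parcs (coral_graph V E n) \<longleftrightarrow> (\<exists>k\<le>n. e \<in> E k)"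
  by (auto simp: coral_graph_def)

lemma arc_reachable:
  assumes "k \<le> n" "(a, b) \<in> E k"
  shows "reachable (with_proj (coral_graph V E n)) a b"
  using assms by (intro gr.reachable_adjI) (auto simp: arcs_graph)

lemma coral_connected:
  assumes "u \<in> G n" "v \<in> G n"
  shows "reachable (with_proj (coral_graph V E n)) u v"
proof -
  obtain v0 v1 where V: "V 0 = {v0, v1}" "E 0 = {(v0, v1), (v1, v0)}"
    using coral_le[OF coral, of 0] by auto
  have *: "reachable (with_proj (coral_graph V E n)) w v0 \<and> reachable (with_proj (coral_graph V E n)) v0 w"
    if "k \<le> n" "w \<in> G k" for k w
    using that
  proof (induction k arbitrary: w)
    case 0
    have "v0 \<in> G n" using V G_mono[of 0 n v0] by (simp add: gens_upto_0)
    then have "reachable (with_proj (coral_graph V E n)) v0 v0"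
      by (intro gr.reachable_refl) (simp add: pverts_coral_graph)
    then show ?case using 0 V arc_reachable[of 0 v0 v1] arc_reachable[of 0 v1 v0] by (auto simp: gens_upto_0)
  next
    case (Suc k)
    show ?case
    proof (cases "w \<in> G k")
      case True
      then show ?thesis using Suc by simp
    next
      case False
      then have w: "w \<in> V (Suc k)" using Suc.prems gen_cases by blast
      then have e: "(w, l w) \<in> E (Suc k)" using edge_from_new[of k w] Suc.prems by simp
      note 1 = arc_reachable[OF Suc.prems(1) e] arc_reachable[OF Suc.prems(1) edge_sym[OF Suc.prems(1) e]]
      have "l w \<in> G k" using parents_in_G[of k w] w Suc.prems by simp
      then show ?thesis using Suc.IH[of "l w"] Suc.prems(1) gr.reachable_trans[OF 1(1)] gr.reachable_trans[OF _ 1(2)] by simp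
    qed
  qed
  show ?thesis using *[of n u] *[of n v] assms gr.reachable_trans[of u v0 v] by simp
qed

abbreviation dst :: "real \<Rightarrow> 'v \<Rightarrow> 'v \<Rightarrow> real" where
  "dst lam \<equiv> coral_dist lam n V E"

lemma coral_dist_attained:
  assumes "0 \<le> lam" "u \<in> G n" "v \<in> G n"
  obtains p where "gr.awalk u p v" "dst lam u v = gr.awalk_cost (coral_weight lam E) p"
    "gr.\<mu> (coral_weight lam E) u v = ereal (dst lam u v)"
proof -
  have "\<exists>p. gr.apath u p v \<and> gr.\<mu> (coral_weight lam E) u v = ereal (gr.awalk_cost (coral_weight lam E) p)"
  proof (rule gr.min_cost_awalk)
    show "reachable (with_proj (coral_graph V E n)) u v" using coral_connected assms by simp
    show "coral_weight lam E e \<ge> 0" for e using assms(1) by (simp add: coral_weight_def)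
  qed
  then obtain p where p: "gr.apath u p v"
    "gr.\<mu> (coral_weight lam E) u v = ereal (gr.awalk_cost (coral_weight lam E) p)" by blast
  show thesis
    by (rule that[OF gr.awalkI_apath[OF p(1)]]) (simp_all add: coral_dist_def p(2))
qed

lemma coral_dist_le:
  assumes "0 \<le> lam" "gr.awalk u p v"
  shows "dst lam u v \<le> gr.awalk_cost (coral_weight lam E) p"
proof -
  have uv: "u \<in> G n" "v \<in> G n"
    using gr.awalk_hd_in_verts[OF assms(2)] gr.awalk_last_in_verts[OF assms(2)] by (simp_all add: pverts_coral_graph)
  show ?thesis
    by (rule coral_dist_attained[OF assms(1) uv])
      (use gr.min_cost_le_walk_cost[OF assms(2), of "coral_weight lam E"] in simp)
qed

lemma coral_dist_edge:
  assumes "0 \<le> lam" "k \<le> n" "(a, b) \<in> E k" "v \<in> G n"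
  shows "dst lam a v \<le> lam ^ k + dst lam b v"
proof -
  have "b \<in> G n" using edge_verts[OF assms(2,3)] G_mono[OF assms(2)] by simp
  then obtain p where p: "gr.awalk b p v" "dst lam b v = gr.awalk_cost (coral_weight lam E) p"
    using coral_dist_attained[OF assms(1) _ assms(4)] by blast
  have "gr.awalk a ((a, b) # p) v"
    using p(1) assms(2,3) by (auto simp: gr.awalk_Cons_iff arcs_graph)
  then have "dst lam a v \<le> gr.awalk_cost (coral_weight lam E) ((a, b) # p)"
    by (rule coral_dist_le[OF assms(1)])
  then show ?thesis using p(2) coral_weight_eq[OF coral assms(2,3)] by simp
qed

lemma coral_dist_self:
  assumes "0 \<le> lam" "v \<in> G n"
  shows "dst lam v v \<le> 0"
  using coral_dist_le[OF assms(1), of v "[]" v] assms(2) by (simp add: gr.awalk_Nil_iff pverts_coral_graph)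

lemma coral_dist_triangle:
  assumes "0 \<le> lam" "u \<in> G n" "v \<in> G n" "w \<in> G n"
  shows "dst lam u w \<le> dst lam u v + dst lam v w"
proof -
  obtain p where p: "gr.awalk u p v" "dst lam u v = gr.awalk_cost (coral_weight lam E) p"
    using coral_dist_attained[OF assms(1-3)] by blast
  obtain p' where p': "gr.awalk v p' w" "dst lam v w = gr.awalk_cost (coral_weight lam E) p'"
    using coral_dist_attained[OF assms(1,3,4)] by blast
  show ?thesis
    using coral_dist_le[OF assms(1) gr.awalk_appendI[OF p(1) p'(1)]] by (simp add: p(2) p'(2))
qed

text \<open>
  The shortest path distance is the largest function with the triangle inequality that is bounded by
  the weights on edges; with the constant \<open>K\<close>, this transfers Lipschitz bounds from edges to pairs of
  vertices.
\<close>

lemma le_coral_dist: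
  assumes "0 \<le> lam" "u \<in> G n" "v \<in> G n"
    and F_self: "\<And>w. w \<in> G n \<Longrightarrow> F w w \<le> 0"
    and F_triangle: "\<And>x y w. x \<in> G n \<Longrightarrow> y \<in> G n \<Longrightarrow> w \<in> G n \<Longrightarrow> F x w \<le> F x y + F y w"
    and F_edge: "\<And>k a b. k \<le> n \<Longrightarrow> (a, b) \<in> E k \<Longrightarrow> F a b \<le> K * lam ^ k"
  shows "F u v \<le> K * dst lam u v"
proof -
  have *: "F u v \<le> K * gr.awalk_cost (coral_weight lam E) p" if "gr.awalk u p v" for u p
    using that
  proof (induction p arbitrary: u)
    case Nil
    then show ?case using F_self[OF assms(3)] by (simp add: gr.awalk_Nil_iff)
  next
    case (Cons e p)
    obtain a b where e: "e = (a, b)" by (cases e)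
    then obtain k where k: "k \<le> n" "(a, b) \<in> E k" and u: "u = a" and p: "gr.awalk b p v"
      using Cons.prems by (auto simp: gr.awalk_Cons_iff arcs_graph)
    have "a \<in> G n" "b \<in> G n" using edge_verts[OF k] G_mono[OF k(1)] by simp_all
    then have "F a v \<le> K * lam ^ k + K * gr.awalk_cost (coral_weight lam E) p"
      using F_triangle[of a b v] assms(3) F_edge[OF k] Cons.IH[OF p] by linarith
    then show ?case
      using coral_weight_eq[OF coral k] by (simp add: e u distrib_left)
  qed
  obtain p where p: "gr.awalk u p v" "dst lam u v = gr.awalk_cost (coral_weight lam E) p"
    using coral_dist_attained[OF assms(1-3)] by blast
  show ?thesis unfolding p(2) by (rule *[OF p(1)])
qed

end

text \<open>
  A map which takes edges to edges of the same generation does not increase distances. Applied to a bijection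
  and its inverse this shows that the distance does not depend on the names of the vertices.
\<close>

lemma coral_dist_hom_le:
  assumes "coral N n V E" "coral N n V' E'" "0 \<le> lam"
    and verts: "\<phi> ` gens_upto V n \<subseteq> gens_upto V' n"
    and edges: "\<And>k a b. k \<le> n \<Longrightarrow> (a, b) \<in> E k \<Longrightarrow> (\<phi> a, \<phi> b) \<in> E' k"
    and uv: "u \<in> gens_upto V n" "v \<in> gens_upto V n"
  shows "coral_dist lam n V' E' (\<phi> u) (\<phi> v) \<le> coral_dist lam n V E u v"
proof -
  obtain l r where "coral_parents N n V E l r" using ex_coral_parents[OF assms(1)] by blast
  then interpret c: coral_parents N n V E l r .
  obtain l' r' where "coral_parents N n V' E' l' r'" using ex_coral_parents[OF assms(2)] by blast
  then interpret c': coral_parents N n V' E' l' r' .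
  have \<phi>: "\<phi> w \<in> gens_upto V' n" if "w \<in> gens_upto V n" for w
    using verts that by blast
  have "coral_dist lam n V' E' (\<phi> u) (\<phi> v) \<le> 1 * coral_dist lam n V E u v"
  proof (rule c.le_coral_dist[where F = "\<lambda>x y. coral_dist lam n V' E' (\<phi> x) (\<phi> y)", OF assms(3) uv])
    fix w assume "w \<in> gens_upto V n"
    then show "coral_dist lam n V' E' (\<phi> w) (\<phi> w) \<le> 0"
      by (intro c'.coral_dist_self[OF assms(3)] \<phi>)
  next
    fix x y w assume "x \<in> gens_upto V n" "y \<in> gens_upto V n" "w \<in> gens_upto V n"
    then show "coral_dist lam n V' E' (\<phi> x) (\<phi> w)
        \<le> coral_dist lam n V' E' (\<phi> x) (\<phi> y) + coral_dist lam n V' E' (\<phi> y) (\<phi> w)"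
      by (intro c'.coral_dist_triangle[OF assms(3)] \<phi>)
  next
    fix k a b assume k: "k \<le> n" "(a, b) \<in> E k"
    have b: "\<phi> b \<in> gens_upto V' n"
      by (rule c'.G_mono[OF k(1) conjunct2[OF c'.edge_verts[OF k(1) edges[OF k]]]])
    show "coral_dist lam n V' E' (\<phi> a) (\<phi> b) \<le> 1 * lam ^ k"
      using c'.coral_dist_edge[OF assms(3) k(1) edges[OF k] b] c'.coral_dist_self[OF assms(3) b]
      by linarith
  qed
  then show ?thesis by simp
qed

lemma gens_upto_image: "gens_upto (\<lambda>i. \<phi> ` V i) k = \<phi> ` gens_upto V k"
  by (auto simp: gens_upto_def)

lemma map_prod_times: "map_prod f g ` (A \<times> B) = f ` A \<times> g ` B"
  by force

lemma ex_new_neighbours: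
  assumes "coral N (Suc k) V E" "v \<in> V (Suc k)"
  shows "\<exists>u w. {b. (v, b) \<in> E (Suc k)} = {u, w} \<and> (u = w \<or> (u, w) \<in> E k)"
  using assms(1) unfolding coral_Suc_iff by (elim conjE) (erule bspec[OF _ assms(2)])

lemma coral_image:
  assumes "coral N n V E" "inj_on \<phi> (gens_upto V n)"
  shows "coral N n (\<lambda>i. \<phi> ` V i) (\<lambda>i. map_prod \<phi> \<phi> ` E i)"
  using assms
proof (induction n)
  case 0
  then obtain v0 v1 where v: "N 0 = 2" "v0 \<noteq> v1" "V 0 = {v0, v1}" "E 0 = {(v0, v1), (v1, v0)}" by auto
  have "inj_on \<phi> {v0, v1}" using 0(2) v(3) by (simp add: gens_upto_0)
  then have "\<phi> v0 \<noteq> \<phi> v1" using v(2) by simp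
  then show ?case
    unfolding coral.simps using v by (intro conjI exI[of _ "\<phi> v0"] exI[of _ "\<phi> v1"]) simp_all
next
  case (Suc k)
  note c = coral_SucD[OF Suc.prems(1)]
  have inj: "inj_on \<phi> (gens_upto V k \<union> V (Suc k))" using Suc.prems(2) by (simp add: gens_upto_Suc)
  have disj: "\<phi> ` V (Suc k) \<inter> \<phi> ` gens_upto V k = {}"
    using inj_on_image_Int[OF inj, of "V (Suc k)" "gens_upto V k"] c(5) by simp
  have card: "card (\<phi> ` V (Suc k)) = N (Suc k)"
    using c(3) card_image[OF inj_on_subset[OF inj, of "V (Suc k)"]] by simp
  have sym: "sym (map_prod \<phi> \<phi> ` E (Suc k))"
  proof (rule symI)
    fix a b assume "(a, b) \<in> map_prod \<phi> \<phi> ` E (Suc k)"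
    then obtain a' b' where ab: "a = \<phi> a'" "b = \<phi> b'" "(a', b') \<in> E (Suc k)" by auto
    show "(b, a) \<in> map_prod \<phi> \<phi> ` E (Suc k)"
      unfolding ab(1,2) by (rule map_prod_imageI[OF symD[OF c(6) ab(3)]])
  qed
  have sub: "map_prod \<phi> \<phi> ` E (Suc k) \<subseteq>
      \<phi> ` V (Suc k) \<times> \<phi> ` gens_upto V k \<union> \<phi> ` gens_upto V k \<times> \<phi> ` V (Suc k)"
    using image_mono[OF c(7), of "map_prod \<phi> \<phi>"] by (simp only: image_Un map_prod_times)
  have new: "\<exists>u w. {b. (\<phi> v, b) \<in> map_prod \<phi> \<phi> ` E (Suc k)} = {u, w} \<and>
      (u = w \<or> (u, w) \<in> map_prod \<phi> \<phi> ` E k)" if v: "v \<in> V (Suc k)" for v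
  proof -
    obtain u w where uw: "{b. (v, b) \<in> E (Suc k)} = {u, w}" "u = w \<or> (u, w) \<in> E k"
      using ex_new_neighbours[OF Suc.prems(1) v] by blast
    have only: "a = v" if "(a, b) \<in> E (Suc k)" "\<phi> a = \<phi> v" for a b
    proof (rule inj_onD[OF inj that(2)])
      show "a \<in> gens_upto V k \<union> V (Suc k)" using c(7) that(1) by auto
    qed (use v in simp)
    have "{b. (\<phi> v, b) \<in> map_prod \<phi> \<phi> ` E (Suc k)} = \<phi> ` {b. (v, b) \<in> E (Suc k)}"
    proof (intro equalityI subsetI)
      fix b' assume "b' \<in> {b. (\<phi> v, b) \<in> map_prod \<phi> \<phi> ` E (Suc k)}"
      then obtain a b where ab: "(a, b) \<in> E (Suc k)" "\<phi> v = \<phi> a" "b' = \<phi> b" by auto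
      have "a = v" using ab(2) by (intro only[OF ab(1)]) simp
      then show "b' \<in> \<phi> ` {b. (v, b) \<in> E (Suc k)}" using ab(1,3) by simp
    next
      fix b' assume "b' \<in> \<phi> ` {b. (v, b) \<in> E (Suc k)}"
      then obtain b where "b' = \<phi> b" "(v, b) \<in> E (Suc k)" by blast
      then show "b' \<in> {b. (\<phi> v, b) \<in> map_prod \<phi> \<phi> ` E (Suc k)}"
        using map_prod_imageI[of v b "E (Suc k)" \<phi> \<phi>] by simp
    qed
    then have "{b. (\<phi> v, b) \<in> map_prod \<phi> \<phi> ` E (Suc k)} = {\<phi> u, \<phi> w}" unfolding uw by simp
    moreover have "\<phi> u = \<phi> w \<or> (\<phi> u, \<phi> w) \<in> map_prod \<phi> \<phi> ` E k"
      using uw(2) map_prod_imageI[of u w "E k" \<phi> \<phi>] by blast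
    ultimately show ?thesis by (intro exI conjI)
  qed
  have old: "coral N k (\<lambda>i. \<phi> ` V i) (\<lambda>i. map_prod \<phi> \<phi> ` E i)"
    by (rule Suc.IH[OF c(1) inj_on_subset[OF inj]]) simp
  show ?case
    unfolding coral_Suc_iff gens_upto_image ball_simps
    by (intro conjI ballI old c(4) finite_imageI c(2) card disj sym sub new)
qed

lemma coral_dist_image:
  assumes "coral N n V E" "inj_on \<phi> (gens_upto V n)" "0 \<le> lam"
    and "u \<in> gens_upto V n" "v \<in> gens_upto V n"
  shows "coral_dist lam n (\<lambda>i. \<phi> ` V i) (\<lambda>i. map_prod \<phi> \<phi> ` E i) (\<phi> u) (\<phi> v) = coral_dist lam n V E u v"
    (is "?d' (\<phi> u) (\<phi> v) = _")
proof (rule antisym)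
  note im = coral_image[OF assms(1,2)]
  show "?d' (\<phi> u) (\<phi> v) \<le> coral_dist lam n V E u v"
    by (rule coral_dist_hom_le[where \<phi> = \<phi>, OF assms(1) im assms(3) _ _ assms(4,5)])
      (simp_all add: gens_upto_image map_prod_imageI)
  define \<psi> where "\<psi> = inv_into (gens_upto V n) \<phi>"
  have \<psi>: "\<psi> (\<phi> a) = a" if "a \<in> gens_upto V n" for a
    using that assms(2) by (simp add: \<psi>_def)
  have "coral_dist lam n V E (\<psi> (\<phi> u)) (\<psi> (\<phi> v)) \<le> ?d' (\<phi> u) (\<phi> v)"
  proof (rule coral_dist_hom_le[where \<phi> = \<psi>, OF im assms(1,3)])
    fix k a b assume k: "k \<le> n" and "(a, b) \<in> map_prod \<phi> \<phi> ` E k"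
    then obtain a' b' where ab: "a = \<phi> a'" "b = \<phi> b'" "(a', b') \<in> E k" by auto
    have "a' \<in> gens_upto V n" "b' \<in> gens_upto V n"
      using coral_edges_subset[OF coral_le[OF assms(1) k]] ab(3) gens_upto_mono[OF k, of V] by auto
    then show "(\<psi> a, \<psi> b) \<in> E k" using ab \<psi> by simp
  qed (use assms(4,5) \<psi> in \<open>auto simp: gens_upto_image\<close>)
  then show "coral_dist lam n V E u v \<le> ?d' (\<phi> u) (\<phi> v)" using \<psi> assms(4,5) by simp
qed

section \<open>Directions in the blocks of a basis\<close>

text \<open>
  The case distinction in the definition of \<open>L\<close> has this purpose: a generation of at most two vertices is
  placed on opposite unit vectors of a line, and a larger one on \<open>4 ^ d\<close> separated vectors in \<open>d \<ge> 2\<close>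
  dimensions.
\<close>

lemma coral_L_cases:
  assumes "1 \<le> k"
  shows "coral_L k = 1 \<and> k \<le> 2 \<or> 2 \<le> coral_L k \<and> k \<le> 4 ^ coral_L k"
proof -
  consider "k = 1 \<or> k = 2" | "k = 3 \<or> k = 4" | "5 \<le> k" using assms by linarith
  then show ?thesis
  proof cases
    case 3
    define j where "j = nat \<lceil>log 4 (real k)\<rceil>"
    have "1 < log 4 (real k)" using 3 by (simp add: less_log_iff)
    then have j: "2 \<le> j" "log 4 (real k) \<le> real j" unfolding j_def by linarith+
    then have "real k \<le> 4 ^ j" using 3 by (simp add: log_le_iff powr_realpow)
    then have "k \<le> 4 ^ j" by (metis of_nat_le_iff of_nat_numeral of_nat_power)
    moreover have "coral_L k = j" using 3 by (simp add: coral_L_def j_def)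
    ultimately show ?thesis using j by simp
  qed (auto simp: coral_L_def)
qed

definition prefix :: "nat \<Rightarrow> (nat \<Rightarrow> real) \<Rightarrow> nat \<Rightarrow> real" where
  "prefix k a = (\<lambda>i. if i < k then a i else 0)"

locale coord_basis =
  fixes m :: nat and p :: "(nat \<Rightarrow> real) \<Rightarrow> real" and C :: real
  assumes coord_norm: "coord_norm m p"
    and basis_const: "coord_basis_constant m p \<le> ereal C"
    and C: "1 \<le> C"

sublocale coord_basis \<subseteq> coord_seminorm p
  using coord_norm by unfold_locales (simp_all add: coord_norm_def)

context coord_basis
begin

lemma p_zero_iff: "p a = 0 \<longleftrightarrow> (\<forall>i<m. a i = 0)"
  using coord_norm by (simp add: coord_norm_def)

lemma prefix_le:
  assumes "k \<le> m"
  shows "p (prefix k a) \<le> C * p a"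
proof (cases "p a = 0")
  case True
  then have "p (prefix k a) = 0" unfolding p_zero_iff by (simp add: prefix_def)
  then show ?thesis using True by simp
next
  case False
  then have pos: "0 < p a" using nonneg[of a] by (simp only: less_le) simp
  have "ereal (p (prefix k a) / p a) \<le> coord_basis_constant m p"
    unfolding coord_basis_constant_def prefix_def
    by (rule SUP_upper2[of "(k, a)"]) (use assms False in simp_all)
  then have "p (prefix k a) / p a \<le> C"
    using order_trans[OF _ basis_const] by (metis ereal_less_eq(3))
  then show ?thesis using pos by (simp add: field_simps)
qed

lemma block_le:
  assumes "j \<le> k" "k \<le> m"
  shows "p (\<lambda>i. if i \<in> {j..<k} then a i else 0) \<le> 2 * C * p a"
proof -
  have "(\<lambda>i. if i \<in> {j..<k} then a i else 0) = (\<lambda>i. prefix k a i - prefix j a i)"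
    using assms(1) by (auto simp: prefix_def fun_eq_iff)
  then show ?thesis
    using diff_le[of "prefix k a" "prefix j a"] prefix_le[of k a] prefix_le[of j a] assms by simp
qed

definition unit :: "nat \<Rightarrow> nat \<Rightarrow> real" where
  "unit j = (\<lambda>i. if i = j then 1 else 0)"

lemma p_unit_pos: "j < m \<Longrightarrow> 0 < p (unit j)"
  using p_zero_iff[of "unit j"] nonneg[of "unit j"] unfolding less_le by (auto simp: unit_def)

text \<open>
  Coordinates are bounded by the norm. The size of the constant does not matter, since it does not enter
  the number of separated vectors.
\<close>

lemma coord_le:
  assumes "j < m"
  shows "\<bar>a j\<bar> \<le> 2 * C / p (unit j) * p a"
proof -
  have "(\<lambda>i. if i \<in> {j..<Suc j} then a i else 0) = (\<lambda>i. a j * unit j i)"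
    by (auto simp: unit_def)
  then have "\<bar>a j\<bar> * p (unit j) \<le> 2 * C * p a"
    using block_le[of j "Suc j" a] assms by (simp add: hom)
  then show ?thesis using p_unit_pos[OF assms] by (simp add: field_simps)
qed

lemma ex_block_directions:
  assumes "finite I" "I \<subseteq> {..<m}" "card I = coral_L k" "1 \<le> k"
  shows "\<exists>Z. finite Z \<and> k \<le> card Z \<and> (\<forall>z\<in>Z. p z = 1 \<and> supported_on I z) \<and>
    (\<forall>z\<in>Z. \<forall>w\<in>Z. z \<noteq> w \<longrightarrow> 1/512 \<le> p (\<lambda>i. z i - w i))"
  using coral_L_cases[OF assms(4)]
proof (elim disjE conjE)
  assume "coral_L k = 1" "k \<le> 2"
  then have "card I = 1" using assms(3) by simp
  then obtain j where j: "I = {j}" by (rule card_1_singletonE)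
  define e where "e = (\<lambda>i. unit j i / p (unit j))"
  have pj: "0 < p (unit j)" using p_unit_pos assms(2) j by auto
  then have e: "p e = 1" unfolding e_def by (intro unit_rescale) simp
  have supp: "supported_on I e" by (simp add: supported_on_def e_def unit_def j)
  have "e j \<noteq> - e j" using pj by (simp add: e_def unit_def)
  then have "e \<noteq> (\<lambda>i. - e i)" by metis
  then have "card {e, \<lambda>i. - e i} = 2" by simp
  moreover have "p (\<lambda>i. e i - - e i) = 2" "p (\<lambda>i. - e i - e i) = 2"
    using hom[of 2 e] hom[of "-2" e] e by (simp_all add: algebra_simps)
  ultimately show ?thesis
    using \<open>k \<le> 2\<close> e supp minus[of e]
    by (intro exI[of _ "{e, \<lambda>i. - e i}"]) (auto simp: supported_on_def)
next
  assume L: "2 \<le> coral_L k" "k \<le> 4 ^ coral_L k"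
  have coord: "\<bar>a i\<bar> \<le> (\<Sum>j\<in>I. 2 * C / p (unit j)) * p a" if "i \<in> I" for a i
  proof -
    have "2 * C / p (unit i) \<le> (\<Sum>j\<in>I. 2 * C / p (unit j))"
      by (rule member_le_sum[OF that _ assms(1)]) (use C in simp)
    then have "2 * C / p (unit i) * p a \<le> (\<Sum>j\<in>I. 2 * C / p (unit j)) * p a"
      by (rule mult_right_mono) simp
    moreover have "i < m" using that assms(2) by auto
    ultimately show ?thesis using coord_le[of i a] by linarith
  qed
  have "2 \<le> card I" using L(1) assms(3) by simp
  have "\<exists>Z. finite Z \<and> 4 ^ card I \<le> card Z \<and> (\<forall>z\<in>Z. p z = 1 \<and> supported_on I z) \<and>
      (\<forall>z\<in>Z. \<forall>w\<in>Z. z \<noteq> w \<longrightarrow> 1/512 \<le> p (\<lambda>i. z i - w i))"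
    by (rule separated_unit_vectors[where R = "\<Sum>j\<in>I. 2 * C / p (unit j)", OF assms(1) \<open>2 \<le> card I\<close>])
      (rule coord)
  then obtain Z where Z: "finite Z" "4 ^ card I \<le> card Z" "\<forall>z\<in>Z. p z = 1 \<and> supported_on I z"
    "\<forall>z\<in>Z. \<forall>w\<in>Z. z \<noteq> w \<longrightarrow> 1/512 \<le> p (\<lambda>i. z i - w i)"
    by (elim exE conjE)
  have "k \<le> card Z" using L(2) Z(2) assms(3) by simp
  then show ?thesis using Z by (intro exI[of _ Z] conjI)
qed

end

definition block :: "(nat \<Rightarrow> nat) \<Rightarrow> nat \<Rightarrow> nat set" where
  "block N k = {(\<Sum>i<k. coral_L (N i))..<(\<Sum>i<Suc k. coral_L (N i))}"

lemma block_disjoint: "i \<noteq> j \<Longrightarrow> block N i \<inter> block N j = {}"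
proof -
  have *: "block N i \<inter> block N j = {}" if "i < j" for i j
  proof -
    have "(\<Sum>i<Suc i. coral_L (N i)) \<le> (\<Sum>i<j. coral_L (N i))"
      using that by (intro sum_mono2) auto
    then show ?thesis by (auto simp: block_def)
  qed
  show "i \<noteq> j \<Longrightarrow> ?thesis" using *[of i j] *[of j i] by (cases "i < j") (simp_all add: Int_commute)
qed

lemma block_end_le: "k \<le> n \<Longrightarrow> (\<Sum>i<Suc k. coral_L (N i)) \<le> (\<Sum>i\<le>n. coral_L (N i))"
  by (intro sum_mono2) auto

lemma coral_card:
  assumes "coral N n V E" "k \<le> n"
  shows "finite (V k) \<and> card (V k) = N k \<and> 1 \<le> N k"
proof (cases k)
  case 0
  then show ?thesis using coral_le[OF assms] by auto
next
  case (Suc j)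
  then have "coral N (Suc j) V E" using coral_le[OF assms] by (simp only:)
  then show ?thesis using coral_SucD(2-4)[of N j V E] Suc by (simp only: simp_thms)
qed

lemma ex_directions:
  assumes "coral N n V E" "coord_basis (\<Sum>i\<le>n. coral_L (N i)) p C"
  shows "\<exists>z. \<forall>k\<le>n. \<forall>v\<in>V k. supported_on (block N k) (z v) \<and> p (z v) = 1 \<and>
    (\<forall>w\<in>V k. v \<noteq> w \<longrightarrow> 1/512 \<le> p (\<lambda>i. z v i - z w i))"
proof -
  interpret coord_basis "\<Sum>i\<le>n. coral_L (N i)" p C by fact
  define good where "good k g \<longleftrightarrow> (\<forall>v\<in>V k. supported_on (block N k) (g v) \<and> p (g v) = 1 \<and>
      (\<forall>w\<in>V k. v \<noteq> w \<longrightarrow> 1/512 \<le> p (\<lambda>i. g v i - g w i)))" for k g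
  have "\<exists>g. good k g" if k: "k \<le> n" for k
  proof -
    have card: "finite (V k)" "card (V k) = N k" "1 \<le> N k" using coral_card[OF assms(1) k] by simp_all
    have "\<exists>Z. finite Z \<and> N k \<le> card Z \<and> (\<forall>z\<in>Z. p z = 1 \<and> supported_on (block N k) z) \<and>
        (\<forall>z\<in>Z. \<forall>w\<in>Z. z \<noteq> w \<longrightarrow> 1/512 \<le> p (\<lambda>i. z i - w i))"
    proof (rule ex_block_directions)
      show "block N k \<subseteq> {..<(\<Sum>i\<le>n. coral_L (N i))}"
        using block_end_le[OF k, of N] by (auto simp: block_def)
    qed (use card(3) in \<open>simp_all add: block_def\<close>)
    then obtain Z where Z: "finite Z" "N k \<le> card Z"
      "\<forall>z\<in>Z. p z = 1 \<and> supported_on (block N k) z"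
      "\<forall>z\<in>Z. \<forall>w\<in>Z. z \<noteq> w \<longrightarrow> 1/512 \<le> p (\<lambda>i. z i - w i)"
      by (elim exE conjE)
    have "card (V k) \<le> card Z" using Z(2) card(2) by simp
    then obtain g where g: "g ` V k \<subseteq> Z" "inj_on g (V k)"
      using inj_on_iff_card_le[OF card(1) Z(1)] by blast
    have "g v \<in> Z" if "v \<in> V k" for v using g(1) that by blast
    moreover have "g v \<noteq> g w" if "v \<in> V k" "w \<in> V k" "v \<noteq> w" for v w
      using g(2) that by (simp add: inj_on_eq_iff)
    ultimately have "good k g" unfolding good_def using Z(3,4) by (intro ballI conjI impI) simp_all
    then show ?thesis by blast
  qed
  then obtain g where g: "\<And>k. k \<le> n \<Longrightarrow> good k (g k)" by metis
  \<comment> \<open>The generation of a vertex is unique, so the choices for the generations fit together.\<close>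
  define z where "z v = g (THE k. k \<le> n \<and> v \<in> V k) v" for v
  have z: "z v = g k v" if "k \<le> n" "v \<in> V k" for k v
  proof -
    have "(THE k. k \<le> n \<and> v \<in> V k) = k"
    proof (rule the_equality)
      fix k' assume "k' \<le> n \<and> v \<in> V k'"
      then show "k' = k" by (elim conjE) (rule coral_gen_unique[OF assms(1) _ that(2) _ that(1)])
    qed (use that in simp)
    then show ?thesis by (simp add: z_def)
  qed
  have "good k z" if "k \<le> n" for k
    using g[OF that] unfolding good_def by (simp add: z[OF that])
  then show ?thesis unfolding good_def by (intro exI[of _ z] allI impI)
qed

section \<open>The embedding\<close>

lemma (in coral_parents) ex_averaging_map:
  fixes z :: "'v \<Rightarrow> nat \<Rightarrow> real"
  shows "\<exists>f. (\<forall>v\<in>V 0. f v = z v) \<and> (\<forall>k<n. \<forall>v\<in>V (Suc k).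
    f v = (\<lambda>i. (f (l v) i + f (r v) i) / 2 + lam ^ Suc k * z v i))"
proof -
  have "\<exists>f. (\<forall>v\<in>V 0. f v = z v) \<and> (\<forall>k<j. \<forall>v\<in>V (Suc k).
    f v = (\<lambda>i. (f (l v) i + f (r v) i) / 2 + lam ^ Suc k * z v i))" if "j \<le> n" for j
    using that
  proof (induction j)
    case 0
    show ?case by (intro exI[of _ z]) simp
  next
    case (Suc j)
    obtain f where f0: "\<forall>v\<in>V 0. f v = z v"
      and fS: "\<forall>k<j. \<forall>v\<in>V (Suc k). f v = (\<lambda>i. (f (l v) i + f (r v) i) / 2 + lam ^ Suc k * z v i)"
      using Suc.IH[OF Suc_leD[OF Suc.prems]] by (elim exE conjE)
    define f' where "f' v = (if v \<in> V (Suc j)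
      then (\<lambda>i. (f (l v) i + f (r v) i) / 2 + lam ^ Suc j * z v i) else f v)" for v
    have old: "f' v = f v" if "v \<in> G j" for v
      using new_notin[of j v] that Suc.prems by (auto simp: f'_def)
    have "f' v = (\<lambda>i. (f' (l v) i + f' (r v) i) / 2 + lam ^ Suc k * z v i)"
      if k: "k < Suc j" and v: "v \<in> V (Suc k)" for k v
    proof -
      have lr: "l v \<in> G k \<and> r v \<in> G k" using parents_in_G[OF _ v] k Suc.prems by simp
      then have "l v \<in> G j" "r v \<in> G j" using G_mono[of k j "l v"] G_mono[of k j "r v"] k by simp_all
      then have *: "f' (l v) = f (l v)" "f' (r v) = f (r v)" using old by simp_all
      show ?thesis
      proof (cases "k = j")
        case True
        then show ?thesis using v unfolding * by (simp add: f'_def)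
      next
        case False
        then have kj: "k < j" using k by simp
        then have "v \<in> G j" using G_mono[of "Suc k" j v] in_G[OF v] by simp
        then show ?thesis using fS[rule_format, OF kj v] unfolding * by (simp add: old)
      qed
    qed
    moreover have "f' v = z v" if "v \<in> V 0" for v
    proof -
      have "v \<in> G j" using G_mono[of 0 j v] in_G[OF that] by simp
      then show ?thesis using old f0 that by simp
    qed
    ultimately show ?case by (intro exI[of _ f']) simp
  qed
  then show ?thesis by blast
qed

lemma distortion_le:
  assumes "u0 \<in> S" "v0 \<in> S" "u0 \<noteq> v0"
    and "\<And>u v. u \<in> S \<Longrightarrow> v \<in> S \<Longrightarrow> u \<noteq> v \<Longrightarrow>
      0 < dX u v \<and> 0 < dY (f u) (f v) \<and> dY (f u) (f v) \<le> A * dX u v \<and> dX u v \<le> K * dY (f u) (f v)"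
  shows "distortion S dX dY f \<le> ereal (A * K)"
proof -
  let ?S = "{(u, v). u \<in> S \<and> v \<in> S \<and> u \<noteq> v}"
  have mem: "(u0, v0) \<in> ?S" using assms by simp
  have 1: "(SUP (u, v)\<in>?S. ereal (dY (f u) (f v) / dX u v)) \<le> ereal A"
    using assms(4) by (intro SUP_least) (auto simp: field_simps)
  have 2: "(SUP (u, v)\<in>?S. ereal (dX u v / dY (f u) (f v))) \<le> ereal K"
    using assms(4) by (intro SUP_least) (auto simp: field_simps)
  have 3: "0 \<le> (SUP (u, v)\<in>?S. ereal (dY (f u) (f v) / dX u v))"
    by (rule SUP_upper2[OF mem]) (use assms(4)[OF assms(1-3)] in simp)
  have 4: "0 \<le> (SUP (u, v)\<in>?S. ereal (dX u v / dY (f u) (f v)))"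
    by (rule SUP_upper2[OF mem]) (use assms(4)[OF assms(1-3)] in simp)
  have "distortion S dX dY f \<le> ereal A * ereal K"
    unfolding distortion_def by (rule ereal_mult_mono[OF order_trans[OF 3 1] 4 1 2])
  then show ?thesis by simp
qed

text \<open>
  The factor \<open>8192 C / (1 - \<lambda>)\<close> is the product of the bound \<open>2 \<lambda>\<^sup>i / (1 - \<lambda>)\<close> on the distance of the vertices
  and of the factor \<open>4 \<cdot> 512 \<cdot> 2 C\<close>, which leads from the norm of the difference of the images to \<open>\<lambda>\<^sup>i\<close>:
  \<open>1 / (4 \<cdot> 512)\<close> is the relative separation in the block and \<open>2 C\<close> bounds the projection onto it.
\<close>

lemma coral_embedding:
  assumes "coral N n V E" "coord_basis (\<Sum>i\<le>n. coral_L (N i)) p C" "1/2 < lam" "lam < 1"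
  shows "\<exists>f. (\<forall>u\<in>gens_upto V n. \<forall>v\<in>gens_upto V n. u \<noteq> v \<longrightarrow> p (\<lambda>i. f u i - f v i) \<noteq> 0) \<and>
    distortion (gens_upto V n) (coral_dist lam n V E) (\<lambda>a b. p (\<lambda>i. a i - b i)) f
      \<le> ereal (2 * lam / (2 * lam - 1) * (8192 * C / (1 - lam)))"
proof -
  let ?m = "\<Sum>i\<le>n. coral_L (N i)"
  interpret b: coord_basis ?m p C by fact
  obtain z where z: "\<forall>k\<le>n. \<forall>v\<in>V k. supported_on (block N k) (z v) \<and> p (z v) = 1 \<and>
      (\<forall>w\<in>V k. v \<noteq> w \<longrightarrow> 1/512 \<le> p (\<lambda>i. z v i - z w i))"
    using ex_directions[OF assms(1,2)] by blast
  obtain l r where "coral_parents N n V E l r" using ex_coral_parents[OF assms(1)] by blast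
  then interpret coral_parents N n V E l r .
  obtain f where f: "\<forall>v\<in>V 0. f v = z v"
    "\<forall>k<n. \<forall>v\<in>V (Suc k). f v = (\<lambda>i. (f (l v) i + f (r v) i) / 2 + lam ^ Suc k * z v i)"
    using ex_averaging_map[of z lam] by blast
  interpret coral_coordinates N n V E l r p lam "1/512" "block N" z f
    by unfold_locales (use assms(3,4) z f block_disjoint[of _ _ N] in simp_all)
  define A where "A = 2 * lam / (2 * lam - 1)"
  have A: "0 < A" using assms(3) by (simp add: A_def)
  have lam0: "0 \<le> lam" using assms(3) by simp
  have upper: "p (\<lambda>i. f u i - f v i) \<le> A * coral_dist lam n V E u v"
    if "u \<in> gens_upto V n" "v \<in> gens_upto V n" for u v
    by (rule le_coral_dist[where F = "\<lambda>u v. p (\<lambda>i. f u i - f v i)", OF lam0 that])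
      (use b.triangle f_edge_le in \<open>simp_all add: A_def\<close>)
  have lower: "0 < p (\<lambda>i. f u i - f v i) \<and>
      coral_dist lam n V E u v \<le> 8192 * C / (1 - lam) * p (\<lambda>i. f u i - f v i)"
    if uv: "u \<in> gens_upto V n" "v \<in> gens_upto V n" "u \<noteq> v" for u v
  proof -
    obtain i where i: "i \<le> n"
      "1/512 / 4 * lam ^ i \<le> p (\<lambda>k. if k \<in> block N i then f u k - f v k else 0)"
      and lip: "\<And>\<phi>. lipschitz \<phi> \<Longrightarrow> \<phi> u - \<phi> v \<le> 2 / (1 - lam) * lam ^ i"
      using vertices_separated[OF uv] by blast
    have "p (\<lambda>k. if k \<in> block N i then f u k - f v k else 0) \<le> 2 * C * p (\<lambda>i. f u i - f v i)"
      unfolding block_def using block_end_le[OF i(1), of N] by (intro b.block_le) auto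
    then have li: "lam ^ i \<le> 4096 * C * p (\<lambda>i. f u i - f v i)" using i(2) by simp
    have "lipschitz (\<lambda>w. coral_dist lam n V E w v)"
      unfolding lipschitz_def
    proof (intro allI impI)
      fix k a b assume k: "k \<le> n" "(a, b) \<in> E k"
      show "\<bar>coral_dist lam n V E a v - coral_dist lam n V E b v\<bar> \<le> lam ^ k"
        using coral_dist_edge[OF lam0 k uv(2)] coral_dist_edge[OF lam0 k(1) edge_sym[OF k] uv(2)]
        by linarith
    qed
    then have "coral_dist lam n V E u v - coral_dist lam n V E v v \<le> 2 / (1 - lam) * lam ^ i"
      by (rule lip)
    then have "coral_dist lam n V E u v \<le> 2 / (1 - lam) * lam ^ i"
      using coral_dist_self[OF lam0 uv(2)] by linarith
    also have "\<dots> \<le> 2 / (1 - lam) * (4096 * C * p (\<lambda>i. f u i - f v i))"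
      using li assms(4) by (intro mult_left_mono) auto
    also have "\<dots> = 8192 * C / (1 - lam) * p (\<lambda>i. f u i - f v i)" by simp
    finally have "coral_dist lam n V E u v \<le> 8192 * C / (1 - lam) * p (\<lambda>i. f u i - f v i)" .
    moreover have "0 < lam ^ i" using assms(3) by simp
    then have "0 < 4096 * C * p (\<lambda>i. f u i - f v i)" using li by linarith
    then have "0 < p (\<lambda>i. f u i - f v i)" using b.C by (simp add: zero_less_mult_iff)
    ultimately show ?thesis by simp
  qed
  obtain v0 v1 where "v0 \<noteq> v1" "V 0 = {v0, v1}" using coral_le[OF assms(1), of 0] by auto
  then have v01: "v0 \<in> gens_upto V n" "v1 \<in> gens_upto V n" "v0 \<noteq> v1"
    using gens_upto_mono[of 0 n V] by (auto simp: gens_upto_0)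
  have "distortion (gens_upto V n) (coral_dist lam n V E) (\<lambda>a b. p (\<lambda>i. a i - b i)) f
      \<le> ereal (A * (8192 * C / (1 - lam)))"
  proof (rule distortion_le[OF v01])
    fix u v assume uv: "u \<in> gens_upto V n" "v \<in> gens_upto V n" "u \<noteq> v"
    have "0 < A * coral_dist lam n V E u v" using lower[OF uv] upper[OF uv(1,2)] by linarith
    then have "0 < coral_dist lam n V E u v" using A by (simp add: zero_less_mult_iff)
    then show "0 < coral_dist lam n V E u v \<and> 0 < p (\<lambda>i. f u i - f v i) \<and>
        p (\<lambda>i. f u i - f v i) \<le> A * coral_dist lam n V E u v \<and>
        coral_dist lam n V E u v \<le> 8192 * C / (1 - lam) * p (\<lambda>i. f u i - f v i)"
      using lower[OF uv] upper[OF uv(1,2)] by blast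
  qed
  moreover have "p (\<lambda>i. f u i - f v i) \<noteq> 0"
    if "u \<in> gens_upto V n" "v \<in> gens_upto V n" "u \<noteq> v" for u v
    using lower[OF that] by simp
  ultimately show ?thesis unfolding A_def by blast
qed

section \<open>Transfer to arbitrary vertex sets and Banach spaces\<close>

text \<open>
  The bound is chosen as some constant that works for corals on the natural numbers and norms on coordinates;
  such constants exist by \<open>coral_embedding\<close>.
\<close>

lemma coral_distortion_bound_works:
  fixes V :: "nat \<Rightarrow> nat set"
  assumes "1 \<le> C" "1/2 < lam" "lam < 1"
    and "coral N n V E" "coord_norm (\<Sum>i\<le>n. coral_L (N i)) p"
    and "coord_basis_constant (\<Sum>i\<le>n. coral_L (N i)) p \<le> ereal C"
  shows "\<exists>f. (\<forall>u\<in>gens_upto V n. \<forall>v\<in>gens_upto V n. u \<noteq> v \<longrightarrow> p (\<lambda>i. f u i - f v i) \<noteq> 0) \<and>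
    distortion (gens_upto V n) (coral_dist lam n V E) (\<lambda>a b. p (\<lambda>i. a i - b i)) f
      \<le> ereal (coral_distortion_bound C lam)"
proof -
  define works where "works D \<longleftrightarrow> (\<forall>n N (V :: nat \<Rightarrow> nat set) E p.
       coral N n V E \<longrightarrow>
       coord_norm (\<Sum>i\<le>n. coral_L (N i)) p \<longrightarrow>
       coord_basis_constant (\<Sum>i\<le>n. coral_L (N i)) p \<le> ereal C \<longrightarrow>
       (\<exists>f. (\<forall>u\<in>pverts (coral_graph V E n). \<forall>v\<in>pverts (coral_graph V E n).
               u \<noteq> v \<longrightarrow> p (\<lambda>i. f u i - f v i) \<noteq> 0) \<and>
            distortion (pverts (coral_graph V E n)) (coral_dist lam n V E)
              (\<lambda>a b. p (\<lambda>i. a i - b i)) f \<le> ereal D))" for D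
  have "works (2 * lam / (2 * lam - 1) * (8192 * C / (1 - lam)))"
    unfolding works_def pverts_coral_graph
  proof (intro allI impI)
    fix n N and V :: "nat \<Rightarrow> nat set" and E p
    assume coral: "coral N n V E" and "coord_norm (\<Sum>i\<le>n. coral_L (N i)) p"
      "coord_basis_constant (\<Sum>i\<le>n. coral_L (N i)) p \<le> ereal C"
    then have "coord_basis (\<Sum>i\<le>n. coral_L (N i)) p C" using assms(1) by unfold_locales
    then show "\<exists>f. (\<forall>u\<in>gens_upto V n. \<forall>v\<in>gens_upto V n. u \<noteq> v \<longrightarrow> p (\<lambda>i. f u i - f v i) \<noteq> 0) \<and>
        distortion (gens_upto V n) (coral_dist lam n V E) (\<lambda>a b. p (\<lambda>i. a i - b i)) f
          \<le> ereal (2 * lam / (2 * lam - 1) * (8192 * C / (1 - lam)))"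
      by (rule coral_embedding[OF coral _ assms(2,3)])
  qed
  then have "works (SOME D. works D)" by (rule someI)
  then have "works (coral_distortion_bound C lam)"
    unfolding coral_distortion_bound_def works_def .
  from this[unfolded works_def, rule_format, OF assms(4-6)] show ?thesis
    unfolding pverts_coral_graph .
qed

lemma distortion_image:
  assumes "inj_on \<phi> S"
    and "\<And>u v. u \<in> S \<Longrightarrow> v \<in> S \<Longrightarrow> dX' (\<phi> u) (\<phi> v) = dX u v"
    and "\<And>u v. dY' (g (\<phi> u)) (g (\<phi> v)) = dY (f u) (f v)"
  shows "distortion (\<phi> ` S) dX' dY' g = distortion S dX dY f"
proof -
  have pairs: "{(u, v). u \<in> \<phi> ` S \<and> v \<in> \<phi> ` S \<and> u \<noteq> v} =
      (\<lambda>(u, v). (\<phi> u, \<phi> v)) ` {(u, v). u \<in> S \<and> v \<in> S \<and> u \<noteq> v}"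
    using assms(1) by (auto simp: inj_on_eq_iff)
  show ?thesis
    unfolding distortion_def pairs image_image
    by (intro arg_cong2[of _ _ _ _ "(*)"] SUP_cong refl) (auto simp: assms(2,3))
qed

locale basic_seq =
  fixes m :: nat and x :: "nat \<Rightarrow> 'a::banach"
  assumes basic: "basic_sequence m x"
begin

definition comb :: "(nat \<Rightarrow> real) \<Rightarrow> 'a" where
  "comb a = (\<Sum>i<m. a i *\<^sub>R x i)"

lemma comb_add: "comb (\<lambda>i. a i + b i) = comb a + comb b"
  by (simp add: comb_def scaleR_add_left sum.distrib)

lemma comb_diff: "comb (\<lambda>i. a i - b i) = comb a - comb b"
  by (simp add: comb_def scaleR_diff_left sum_subtractf)

lemma comb_scale: "comb (\<lambda>i. c * a i) = c *\<^sub>R comb a"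
  by (simp add: comb_def scaleR_sum_right)

lemma comb_eq_0_iff: "comb a = 0 \<longleftrightarrow> (\<forall>i<m. a i = 0)"
proof
  assume 0: "comb a = 0"
  have inj: "inj_on x {..<m}" and ind: "independent (x ` {..<m})"
    using basic by (auto simp: basic_sequence_def)
  show "\<forall>i<m. a i = 0"
  proof (intro allI impI)
    fix i assume i: "i < m"
    have "(\<Sum>y\<in>x ` {..<m}. a (inv_into {..<m} x y) *\<^sub>R y) = comb a"
      unfolding comb_def using inj by (simp add: sum.reindex)
    then have "a (inv_into {..<m} x (x i)) = 0"
      using independentD[OF ind, of "x ` {..<m}" "\<lambda>y. a (inv_into {..<m} x y)" "x i"] 0 i by simp
    then show "a i = 0" using inj i by simp
  qed
qed (simp add: comb_def)

lemma coord_norm_comb: "coord_norm m (\<lambda>a. norm (comb a))"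
  unfolding coord_norm_def by (simp add: comb_add comb_scale norm_triangle_ineq comb_eq_0_iff)

lemma comb_prefix: "k \<le> m \<Longrightarrow> comb (\<lambda>i. if i < k then a i else 0) = (\<Sum>i<k. a i *\<^sub>R x i)"
  unfolding comb_def by (intro sum.mono_neutral_cong_right) auto

lemma coord_basis_constant_comb: "coord_basis_constant m (\<lambda>a. norm (comb a)) = basis_constant m x"
  unfolding coord_basis_constant_def basis_constant_def comb_def[symmetric]
  by (intro SUP_cong) (auto simp: comb_prefix)

end

theorem theorem4p3:
  fixes C lam :: real
    and n :: nat and N :: "nat \<Rightarrow> nat"
    and V :: "nat \<Rightarrow> 'v set" and E :: "nat \<Rightarrow> 'v rel"
    and x :: "nat \<Rightarrow> 'a::banach"
  assumes "C \<ge> 1" and "1/2 < lam" and "lam < 1"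
    and "coral N n V E"
    and "basic_sequence (\<Sum>i\<le>n. coral_L (N i)) x"
    and "basis_constant (\<Sum>i\<le>n. coral_L (N i)) x \<le> ereal C"
  shows "\<exists>f :: 'v \<Rightarrow> 'a.
           inj_on f (pverts (coral_graph V E n)) \<and>
           distortion (pverts (coral_graph V E n)) (coral_dist lam n V E) dist f
             \<le> ereal (coral_distortion_bound C lam)"
proof -
  let ?S = "gens_upto V n"
  interpret basic_seq "\<Sum>i\<le>n. coral_L (N i)" x by unfold_locales (rule assms(5))
  obtain \<phi> :: "'v \<Rightarrow> nat" where \<phi>: "inj_on \<phi> ?S"
    using finite_imp_inj_to_nat_seg[OF coral_finite[OF assms(4)]] by blast
  obtain g where g: "\<forall>u\<in>\<phi> ` ?S. \<forall>v\<in>\<phi> ` ?S. u \<noteq> v \<longrightarrow> norm (comb (\<lambda>i. g u i - g v i)) \<noteq> 0"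
    "distortion (\<phi> ` ?S) (coral_dist lam n (\<lambda>i. \<phi> ` V i) (\<lambda>i. map_prod \<phi> \<phi> ` E i))
      (\<lambda>a b. norm (comb (\<lambda>i. a i - b i))) g \<le> ereal (coral_distortion_bound C lam)"
    using coral_distortion_bound_works[OF assms(1-3) coral_image[OF assms(4) \<phi>] coord_norm_comb] assms(6)
    unfolding coord_basis_constant_comb gens_upto_image by blast
  define f where "f v = comb (g (\<phi> v))" for v
  have dist_f: "norm (comb (\<lambda>i. g (\<phi> u) i - g (\<phi> v) i)) = dist (f u) (f v)" for u v
    by (simp add: f_def comb_diff dist_norm)
  have "inj_on f ?S"
  proof (rule inj_onI, rule ccontr)
    fix u v assume uv: "u \<in> ?S" "v \<in> ?S" "f u = f v" "u \<noteq> v"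
    then have "\<phi> u \<noteq> \<phi> v" using \<phi> by (simp add: inj_on_eq_iff)
    then have "norm (comb (\<lambda>i. g (\<phi> u) i - g (\<phi> v) i)) \<noteq> 0" using g(1) uv(1,2) by blast
    then show False using uv(3) unfolding dist_f by simp
  qed
  moreover have "distortion ?S (coral_dist lam n V E) dist f
      = distortion (\<phi> ` ?S) (coral_dist lam n (\<lambda>i. \<phi> ` V i) (\<lambda>i. map_prod \<phi> \<phi> ` E i))
          (\<lambda>a b. norm (comb (\<lambda>i. a i - b i))) g"
    using coral_dist_image[OF assms(4) \<phi>] assms(2) dist_f
    by (intro distortion_image[OF \<phi>, symmetric]) auto
  ultimately show ?thesis unfolding pverts_coral_graph using g(2) by (intro exI[of _ f]) simp
qed

end
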